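(* Let $N\ge4$ and $\kappa\in\mathbb R$ be such that the $2(N-1)^3\times2(N-1)^3$ block matrix $\tilde A=\begin{bmatrix}\tilde A^{11}&\tilde A^{12}\\ \tilde A^{21}&\tilde A^{22}\end{bmatrix}$ is nonsingular, and let $A=\begin{bmatrix}A^{11}&A^{12}\\ A^{21}&A^{22}\end{bmatrix}$. Then the eigenspace $\{\boldsymbol v:\tilde A^{-1}A\boldsymbol v=\boldsymbol v\}$ of $\tilde A^{-1}A$ associated with the eigenvalue $1$ has dimension $2(N-3)^3$.
   Context: $M,S$ are the $(N-1)\times(N-1)$ matrices $M_{mn}=(\psi_{n+1},\psi_{m+1})$, $S_{mn}=(\phi_n',\phi_m')$, with $(\cdot,\cdot)$ the $L^2(-1,1)$ inner product, $L_n$ the Legendre polynomial of degree $n$, $P_n^{(-1,-1)}=\frac{n-1}{2(2n-1)}(L_n-L_{n-2})$ ($n\ge2$), $\psi_{m+1}=\frac{\sqrt{2(2m+1)}}{m}P_{m+1}^{(-1,-1)}$, $\phi_m=\sqrt{\frac{2m+1}{2}}L_m$. $I$ is the $(N-1)\times(N-1)$ identity, $\otimes$ the Kronecker product. $A^{11}=S\otimes M\otimes I+S\otimes I\otimes M+I\otimes M\otimes S+I\otimes S\otimes M+2I\otimes I\otimes I+\kappa(I\otimes I\otimes M+I\otimes M\otimes I)$, $A^{22}=M\otimes S\otimes I+S\otimes I\otimes M+M\otimes I\otimes S+I\otimes S\otimes M+2I\otimes I\otimes I+\kappa(I\otimes I\otimes M+M\otimes I\otimes I)$, $A^{12}=A^{21}=S\otimes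 I\otimes M+I\otimes S\otimes M+I\otimes I\otimes I+\kappa I\otimes I\otimes M$, and $\tilde A^{ij}$ is obtained from $A^{ij}$ by replacing every occurrence of $S$ by $M^{-1}$. ($A$ is the interior-mode block of the divergence-free spectral Galerkin matrix for the 3D curl-curl problem $\nabla\times\nabla\times\boldsymbol u+\kappa\boldsymbol u=\boldsymbol f$.) *)

theory Defs
  imports "HOL-Analysis.Analysis" "HOL-Computational_Algebra.Polynomial"
    "Jordan_Normal_Form.Matrix_Kernel" "Jordan_Normal_Form.Char_Poly"
    "Jordan_Normal_Form.Gauss_Jordan_Elimination"
begin

text \<open>Legendre polynomials via Bonnet's recurrence:
  L_0 = 1, L_1 = x, (n+2) L_{n+2} = (2n+3) x L_{n+1} - (n+1) L_n.\<close>
fun legendre :: "nat \<Rightarrow> real poly" where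
  "legendre 0 = 1"
| "legendre (Suc 0) = [:0, 1:]"
| "legendre (Suc (Suc n)) =
     Polynomial.smult (1 / real (n + 2))
       (Polynomial.smult (real (2 * n + 3)) ([:0, 1:] * legendre (Suc n)) - Polynomial.smult (real (n + 1)) (legendre n))"

definition l2ip :: "real poly \<Rightarrow> real poly \<Rightarrow> real" where
  "l2ip p q = integral {-1..1} (\<lambda>x. poly p x * poly q x)"

text \<open>P_n^{(-1,-1)} = (n-1)/(2(2n-1)) (L_n - L_{n-2}), n \<ge> 2.\<close>
definition jacobi_m1 :: "nat \<Rightarrow> real poly" where
  "jacobi_m1 n = Polynomial.smult ((real n - 1) / (2 * (2 * real n - 1))) (legendre n - legendre (n - 2))"

text \<open>psi_{m+1} = sqrt(2(2m+1))/m P_{m+1}^{(-1,-1)}; here psi m denotes psi_{m+1}.\<close>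
definition psi :: "nat \<Rightarrow> real poly" where
  "psi m = Polynomial.smult (sqrt (2 * (2 * real m + 1)) / real m) (jacobi_m1 (m + 1))"

definition phi :: "nat \<Rightarrow> real poly" where
  "phi m = Polynomial.smult (sqrt ((2 * real m + 1) / 2)) (legendre m)"

definition massM :: "nat \<Rightarrow> real mat" where
  "massM N = mat (N - 1) (N - 1) (\<lambda>(i, j). l2ip (psi (j + 1)) (psi (i + 1)))"

definition stiffS :: "nat \<Rightarrow> real mat" where
  "stiffS N = mat (N - 1) (N - 1) (\<lambda>(i, j). l2ip (pderiv (phi (j + 1))) (pderiv (phi (i + 1))))"

definition kron :: "'a :: times mat \<Rightarrow> 'a mat \<Rightarrow> 'a mat" where
  "kron A B = mat (dim_row A * dim_row B) (dim_col A * dim_col B)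
     (\<lambda>(i, j). A $$ (i div dim_row B, j div dim_col B) * B $$ (i mod dim_row B, j mod dim_col B))"

definition kron3 :: "'a :: times mat \<Rightarrow> 'a mat \<Rightarrow> 'a mat \<Rightarrow> 'a mat" where
  "kron3 A B C = kron (kron A B) C"

text \<open>Blocks, with the matrix S passed as a parameter (so that the tilde versions are
  obtained by substituting M^{-1} for S). I is the (N-1)x(N-1) identity.\<close>
definition blk11 :: "nat \<Rightarrow> real \<Rightarrow> real mat \<Rightarrow> real mat \<Rightarrow> real mat" where
  "blk11 N \<kappa> S M = (let I = 1\<^sub>m (N - 1) in
     kron3 S M I + kron3 S I M + kron3 I M S + kron3 I S M + 2 \<cdot>\<^sub>m kron3 I I I
     + \<kappa> \<cdot>\<^sub>m (kron3 I I M + kron3 I M I))"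

definition blk22 :: "nat \<Rightarrow> real \<Rightarrow> real mat \<Rightarrow> real mat \<Rightarrow> real mat" where
  "blk22 N \<kappa> S M = (let I = 1\<^sub>m (N - 1) in
     kron3 M S I + kron3 S I M + kron3 M I S + kron3 I S M + 2 \<cdot>\<^sub>m kron3 I I I
     + \<kappa> \<cdot>\<^sub>m (kron3 I I M + kron3 M I I))"

definition blk12 :: "nat \<Rightarrow> real \<Rightarrow> real mat \<Rightarrow> real mat \<Rightarrow> real mat" where
  "blk12 N \<kappa> S M = (let I = 1\<^sub>m (N - 1) in
     kron3 S I M + kron3 I S M + kron3 I I I + \<kappa> \<cdot>\<^sub>m kron3 I I M)"

definition blockmat :: "nat \<Rightarrow> real \<Rightarrow> real mat \<Rightarrow> real mat \<Rightarrow> real mat" where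
  "blockmat N \<kappa> S M = four_block_mat (blk11 N \<kappa> S M) (blk12 N \<kappa> S M)
                                       (blk12 N \<kappa> S M) (blk22 N \<kappa> S M)"

text \<open>Matrix inverse (meaningful for nonsingular square matrices).\<close>
definition mat_inv :: "real mat \<Rightarrow> real mat" where
  "mat_inv X = the (mat_inverse X)"

definition matA :: "nat \<Rightarrow> real \<Rightarrow> real mat" where
  "matA N \<kappa> = blockmat N \<kappa> (stiffS N) (massM N)"

definition matAt :: "nat \<Rightarrow> real \<Rightarrow> real mat" where
  "matAt N \<kappa> = blockmat N \<kappa> (mat_inv (massM N)) (massM N)"

end

theory Submission
  imports Defs
begin

text \<open>Since psi_m' = phi_m, integration by parts gives (phi_n', psi_m) = - delta_{mn}.  Let H and G be the
  matrices of coordinates of the psi_n and of the phi_n' in the orthonormal basis phi_0, ..., phi_N.  By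
  Parseval, M = H^T H, S = G^T G and G^T H = -I, so that D = S - M^{-1} = R^T R for R = G + H M^{-1}, which is
  the projection of the phi_n' onto the orthogonal complement of the span of the psi_m.  Moreover D M y = 0
  says that psi_y = sum y_n psi_n is minus the derivative of a polynomial of degree at most N-1, which holds iff
  the last two entries of y vanish.

  The kernel of At^{-1} A - I is the kernel of A - At, whose blocks are sums of Kronecker products of D, M, I.
  The quadratic form of A - At at (u, v) is a sum of six squares, namely of the images of u under
  R x H x I and I x H x R, of v under H x R x I and H x I x R, and of u + v under R x I x H and I x R x H.
  As M is invertible, they all vanish iff D annihilates u and v in each of the three tensor slots.
  Substituting u, v by M x M x M applied to them turns this into the vanishing of coordinates.\<close>

unbundle no vec_syntax
unbundle no inner_syntax

section \<open>Legendre polynomials\<close>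

lemma legendre_rec:
  "Polynomial.smult (real n + 2) (legendre (n+2)) = Polynomial.smult (2 * real n + 3) ([:0,1:] * legendre (n+1))
     - Polynomial.smult (real n + 1) (legendre n)"
proof -
  have "Polynomial.smult (real n + 2) (legendre (n+2)) = Polynomial.smult ((real n + 2) * (1 / real (n + 2)))
       (Polynomial.smult (real (2 * n + 3)) ([:0, 1:] * legendre (Suc n)) - Polynomial.smult (real (n + 1)) (legendre n))"
    by (simp del: mult_pCons_left mult_pCons_right of_nat_add)
  also have "(real n + 2) * (1 / real (n + 2)) = 1" by simp
  finally show ?thesis by (simp add: add.commute)
qed

lemma poly_legendre_rec:
  "(real n + 2) * poly (legendre (n+2)) x = (2 * real n + 3) * (x * poly (legendre (n+1)) x) - (real n + 1) * poly (legendre n) x"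
  using arg_cong[OF legendre_rec, of "\<lambda>p. poly p x" n] by (simp del: legendre.simps)

lemma poly_legendre_one: "poly (legendre n) 1 = 1"
proof (induction n rule: legendre.induct)
  case (3 n)
  have "(real n + 2) * poly (legendre (n+2)) 1 = (real n + 2) * 1"
    unfolding poly_legendre_rec using 3 by simp
  hence "poly (legendre (n+2)) 1 = 1" by (subst (asm) mult_left_cancel) auto
  then show ?case by simp
qed auto

lemma poly_legendre_minus_one: "poly (legendre n) (-1) = (-1) ^ n"
proof (induction n rule: legendre.induct)
  case (3 n)
  have "(real n + 2) * poly (legendre (n+2)) (-1) = (real n + 2) * (-1)^n"
    unfolding poly_legendre_rec using 3 by (simp add: algebra_simps)
  hence "poly (legendre (n+2)) (-1) = (-1)^n" by (subst (asm) mult_left_cancel) auto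
  then show ?case by simp
qed auto

lemma degree_legendre: "degree (legendre n) = n"
proof (induction n rule: legendre.induct)
  case (3 n)
  let ?p = "Polynomial.smult (real (2 * n + 3)) ([:0, 1:] * legendre (Suc n))"
  let ?q = "Polynomial.smult (real (n + 1)) (legendre n)"
  have ne: "legendre (Suc n) \<noteq> 0" using poly_legendre_one[of "Suc n"] by auto
  have "degree ?p = Suc (Suc n)"
    using 3 ne by (simp add: degree_mult_eq del: mult_pCons_left mult_pCons_right legendre.simps)
  moreover have "degree ?q \<le> n" using 3 by simp
  ultimately have "degree (?p - ?q) = Suc (Suc n)"
    by (metis diff_conv_add_uminus degree_add_eq_left degree_minus le_imp_less_Suc less_SucI)
  then show ?case by (simp del: mult_pCons_left mult_pCons_right of_nat_add)
qed auto

text \<open>The two classical identities share one induction: differentiating Bonnet's recurrence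
  and eliminating \<open>a'\<close> by the second identity gives the next first one, and the next
  second one needs both together with the recurrence itself.\<close>

lemma legendre_deriv_aux:
  "poly (pderiv (legendre (Suc n))) x = x * poly (pderiv (legendre n)) x + (real n + 1) * poly (legendre n) x \<and>
   x * poly (pderiv (legendre (Suc n))) x - poly (pderiv (legendre n)) x = (real n + 1) * poly (legendre (Suc n)) x"
proof (induction n)
  case 0
  then show ?case by (simp add: pderiv_pCons)
next
  case (Suc n)
  define a where "a = poly (legendre n) x"
  define b where "b = poly (legendre (n+1)) x"
  define c where "c = poly (legendre (n+2)) x"
  define a' where "a' = poly (pderiv (legendre n)) x"
  define b' where "b' = poly (pderiv (legendre (n+1))) x"
  define c' where "c' = poly (pderiv (legendre (n+2))) x"
  note defs = a_def b_def c_def a'_def b'_def c'_def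
  have r: "(real n + 2) * c = (2 * real n + 3) * (x * b) - (real n + 1) * a"
    unfolding defs by (rule poly_legendre_rec)
  have r': "(real n + 2) * c' = (2 * real n + 3) * (b + x * b') - (real n + 1) * a'"
    using arg_cong[OF legendre_rec, of "\<lambda>p. poly (pderiv p) x" n] unfolding defs
    by (simp add: pderiv_smult pderiv_diff pderiv_mult pderiv_pCons del: legendre.simps mult_pCons_left mult_pCons_right)
  have i1: "b' = x * a' + (real n + 1) * a" and i2: "x * b' - a' = (real n + 1) * b"
    using Suc unfolding defs by auto
  have "(real n + 2) * c' = (real n + 2) * (x * b' + (real n + 2) * b)"
  proof -
    have a: "a' = x * b' - (real n + 1) * b" using i2 by simp
    show ?thesis unfolding r' a by (simp add: algebra_simps)
  qed
  hence c1: "c' = x * b' + (real n + 2) * b" by (subst (asm) mult_left_cancel) auto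
  have "x * c' - b' = x * x * b' + (real n + 2) * x * b - b'" unfolding c1 by (simp add: algebra_simps)
  also have "\<dots> = (real n + 2) * c"
  proof -
    have "(real n + 1) * a = b' - x * (x * b' - (real n + 1) * b)" using i1 i2 by simp
    thus ?thesis unfolding r by (simp add: algebra_simps)
  qed
  finally show ?case using c1 unfolding defs by (simp del: legendre.simps add: add.commute)
qed

text \<open>Adding the first derivative identity at \<open>n+1\<close> to the second at
  \<open>n\<close> cancels the terms x L_{n+1}'. This is what makes psi_m an antiderivative of
  phi_m.\<close>

lemma pderiv_legendre_diff:
  "pderiv (legendre (n+2) - legendre n) = Polynomial.smult (2 * real n + 3) (legendre (n+1))"
proof (rule poly_ext)
  fix x
  have "poly (pderiv (legendre (n+2))) x - poly (pderiv (legendre n)) x = (2 * real n + 3) * poly (legendre (n+1)) x"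
    using conjunct1[OF legendre_deriv_aux[of "n+1" x]] conjunct2[OF legendre_deriv_aux[of n x]]
    by (simp del: legendre.simps add: algebra_simps)
  thus "poly (pderiv (legendre (n+2) - legendre n)) x = poly (Polynomial.smult (2 * real n + 3) (legendre (n+1))) x"
    by (simp add: pderiv_diff del: legendre.simps)
qed

section \<open>The L^2 inner product and Legendre orthogonality\<close>

lemma integrable_poly: "(\<lambda>x. poly p x) integrable_on {a..b::real}"
  by (intro integrable_continuous_real continuous_intros)

lemma l2ip_commute: "l2ip p q = l2ip q p"
  by (simp add: l2ip_def mult.commute)

lemma l2ip_poly: "l2ip p q = integral {-1..1} (poly (p * q))"
  by (simp add: l2ip_def fun_eq_iff cong: Henstock_Kurzweil_Integration.integral_cong)

lemma l2ip_add_left: "l2ip (p + q) r = l2ip p r + l2ip q r"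
  unfolding l2ip_poly distrib_right poly_add[abs_def]
  by (subst Henstock_Kurzweil_Integration.integral_add[symmetric]) (auto intro!: integrable_poly)

lemma l2ip_smult_left: "l2ip (Polynomial.smult c p) q = c * l2ip p q"
  unfolding l2ip_def by (simp add: mult.assoc)

lemma l2ip_add_right: "l2ip r (p + q) = l2ip r p + l2ip r q"
  by (metis l2ip_add_left l2ip_commute)

lemma l2ip_smult_right: "l2ip q (Polynomial.smult c p) = c * l2ip q p"
  by (metis l2ip_smult_left l2ip_commute)

lemma l2ip_diff_left: "l2ip (p - q) r = l2ip p r - l2ip q r"
  using l2ip_add_left[of p "Polynomial.smult (-1) q" r] l2ip_smult_left[of "-1" q r] by simp

lemma l2ip_zero_left [simp]: "l2ip 0 q = 0"
  by (simp add: l2ip_def)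

lemma l2ip_zero_right [simp]: "l2ip q 0 = 0"
  by (simp add: l2ip_def)

lemma l2ip_sum_left: "l2ip (\<Sum>i\<in>A. f i) q = (\<Sum>i\<in>A. l2ip (f i) q)"
  by (induction A rule: infinite_finite_induct) (auto simp: l2ip_add_left)

lemma l2ip_pderiv:
  "l2ip (pderiv p) q = poly p 1 * poly q 1 - poly p (-1) * poly q (-1) - l2ip p (pderiv q)"
proof -
  have "((poly (pderiv (p * q))) has_integral (poly (p*q) 1 - poly (p*q) (-1))) {-1..1}"
    by (rule fundamental_theorem_of_calculus)
       (simp_all only: has_real_derivative_iff_has_vector_derivative[symmetric]
          has_field_derivative_at_within[OF poly_DERIV])
  hence "integral {-1..1} (poly (pderiv (p * q))) = poly (p*q) 1 - poly (p*q) (-1)"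
    by (rule integral_unique)
  moreover have "integral {-1..1} (poly (pderiv (p * q))) = l2ip (pderiv p) q + l2ip p (pderiv q)"
    unfolding l2ip_poly pderiv_mult poly_add[abs_def]
    by (subst Henstock_Kurzweil_Integration.integral_add)
       (auto intro!: integrable_poly simp: mult.commute add.commute)
  ultimately show ?thesis by simp
qed

text \<open>L_{n+2} - L_n vanishes at both endpoints, so integration by parts leaves no boundary
  terms. The identity trades \<open>q\<close> for its derivative, which permits induction on the
  degree.\<close>

lemma l2ip_legendre_pderiv:
  "(2 * real n + 3) * l2ip (legendre (n+1)) q = l2ip (legendre n) (pderiv q) - l2ip (legendre (n+2)) (pderiv q)"
proof -
  have "(2 * real n + 3) * l2ip (legendre (n+1)) q = l2ip (pderiv (legendre (n+2) - legendre n)) q"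
    unfolding pderiv_legendre_diff by (simp add: l2ip_smult_left)
  also have "\<dots> = - l2ip (legendre (n+2) - legendre n) (pderiv q)"
    unfolding l2ip_pderiv by (simp add: poly_legendre_one poly_legendre_minus_one del: legendre.simps)
  finally show ?thesis by (simp add: l2ip_diff_left)
qed

text \<open>With n = k + 1, the preceding identity reduces the claim to \<open>pderiv q\<close>
  tested against L_k and L_{k+2}; the degree of \<open>pderiv q\<close> is below both indices.
  Constants, whose derivative is zero, end the induction.\<close>

lemma l2ip_legendre_lower: "degree q < n \<Longrightarrow> l2ip (legendre n) q = 0"
proof (induction "degree q" arbitrary: q n rule: less_induct)
  case less
  then obtain k where n: "n = k + 1" by (metis Suc_eq_plus1 less_imp_Suc_add)
  have "l2ip (legendre k) (pderiv q) = 0 \<and> l2ip (legendre (k + 2)) (pderiv q) = 0"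
  proof (cases "degree q = 0")
    case True
    hence "pderiv q = 0" by (simp add: pderiv_eq_0_iff)
    thus ?thesis by simp
  next
    case False
    hence "degree (pderiv q) < degree q" "degree (pderiv q) < k" using less.prems n
      by (auto simp: degree_pderiv)
    thus ?thesis using less.hyps[of "pderiv q"] by (simp del: legendre.simps)
  qed
  with l2ip_legendre_pderiv[of k q] have "(2 * real k + 3) * l2ip (legendre (k+1)) q = 0" by simp
  moreover have "2 * real k + 3 \<noteq> 0" by linarith
  ultimately show ?case unfolding n by simp
qed

text \<open>For q = L_{n+1} the same identity loses its L_{n+2} term by orthogonality, and L_{n+1}'
  is (2n+1) L_n plus L_{n-1}', which is orthogonal to L_n. Hence (2n+3) |L_{n+1}|^2 = (2n+1)
  |L_n|^2.\<close>

lemma l2ip_legendre_self: "l2ip (legendre n) (legendre n) = 2 / (2 * real n + 1)"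
proof (induction n)
  case 0
  then show ?case by (simp add: l2ip_def)
next
  case (Suc n)
  have eq: "(2 * real n + 3) * l2ip (legendre (n+1)) (legendre (n+1)) = l2ip (legendre n) (pderiv (legendre (n+1)))"
    unfolding l2ip_legendre_pderiv
    by (subst (2) l2ip_legendre_lower) (auto simp: degree_pderiv degree_legendre)
  have "l2ip (legendre n) (pderiv (legendre (n+1))) = (2 * real n + 1) * l2ip (legendre n) (legendre n)"
  proof (cases n)
    case 0
    thus ?thesis by (simp add: l2ip_def pderiv_pCons)
  next
    case (Suc k)
    have "pderiv (legendre (n+1)) = Polynomial.smult (2 * real n + 1) (legendre n) + pderiv (legendre k)"
      using pderiv_legendre_diff[of k] Suc by (simp add: pderiv_diff algebra_simps del: legendre.simps)
    moreover have "l2ip (legendre n) (pderiv (legendre k)) = 0"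
      by (rule l2ip_legendre_lower) (auto simp: degree_pderiv degree_legendre Suc)
    ultimately show ?thesis by (simp add: l2ip_add_right l2ip_smult_right)
  qed
  also have "\<dots> = 2" using Suc by (simp add: field_simps)
  finally show ?case using eq by (simp add: field_simps)
qed

section \<open>The orthonormal basis phi and its antiderivatives psi\<close>

lemma degree_phi: "degree (phi n) = n"
  by (simp add: phi_def degree_legendre)

lemma phi_orthonormal: "l2ip (phi m) (phi n) = (if m = n then 1 else 0)"
proof -
  have "l2ip (legendre m) (legendre n) = 0" if "m \<noteq> n"
    using that l2ip_legendre_lower[of "legendre n" m] l2ip_legendre_lower[of "legendre m" n]
    by (cases "m < n") (auto simp: degree_legendre l2ip_commute)
  moreover have "sqrt ((2 * real n + 1) / 2) * sqrt ((2 * real n + 1) / 2) = (2 * real n + 1) / 2" by simp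
  ultimately show ?thesis
    by (simp add: phi_def l2ip_smult_left l2ip_smult_right l2ip_legendre_self
        flip: mult.assoc del: real_sqrt_divide)
qed

lemma l2ip_phi_lower: "degree q < n \<Longrightarrow> l2ip (phi n) q = 0"
  by (simp add: phi_def l2ip_smult_left l2ip_legendre_lower)

text \<open>With s = sqrt(2(2m+1)) the two normalising factors multiply to (s/m) (m/s^2) =
  1/s.\<close>

lemma psi_eq: "m \<ge> 1 \<Longrightarrow> psi m = Polynomial.smult (1 / sqrt (2 * (2 * real m + 1))) (legendre (m+1) - legendre (m-1))"
proof -
  assume m: "m \<ge> 1"
  define s where "s = sqrt (2 * (2 * real m + 1))"
  have s: "s * s = 2 * (2 * real m + 1)" "s > 0" by (auto simp: s_def)
  have "s / real m * (real m / (s * s)) = 1 / s"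
    using m s(2) by (simp add: field_simps)
  hence "s / real m * (real m / (2 * (2 * real m + 1))) = 1 / s" using s(1) by simp
  thus ?thesis using m by (simp add: psi_def jacobi_m1_def s_def add.commute del: legendre.simps)
qed

lemma pderiv_psi: assumes "m \<ge> 1" shows "pderiv (psi m) = phi m"
proof -
  obtain k where k: "m = k + 1" using assms by (metis Suc_eq_plus1 Suc_le_D One_nat_def)
  define s where "s = sqrt (2 * real m + 1)"
  have s: "s * s = 2 * real m + 1" "s > 0" by (auto simp: s_def)
  have "(2 * real m + 1) / (sqrt 2 * s) = s / sqrt 2"
    unfolding s(1)[symmetric] using s(2) by simp
  hence c: "1 / sqrt (2 * (2 * real m + 1)) * (2 * real m + 1) = sqrt ((2 * real m + 1) / 2)"
    by (simp only: real_sqrt_mult real_sqrt_divide s_def times_divide_eq_left mult_1)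
  have "pderiv (legendre (m+1) - legendre (m-1)) = Polynomial.smult (2 * real m + 1) (legendre m)"
    using pderiv_legendre_diff[of k] k by (simp add: add.commute del: legendre.simps)
  thus ?thesis unfolding psi_eq[OF assms] pderiv_smult phi_def smult_smult c[symmetric] by simp
qed

lemma poly_psi_ends: "m \<ge> 1 \<Longrightarrow> poly (psi m) 1 = 0" "m \<ge> 1 \<Longrightarrow> poly (psi m) (-1) = 0"
proof -
  assume m: "m \<ge> 1"
  have "(-1::real) ^ (m + 1) = (-1) ^ (m - 1)" using m by (cases m) auto
  thus "poly (psi m) (-1) = 0" unfolding psi_eq[OF m] poly_smult poly_diff poly_legendre_minus_one by simp
  show "poly (psi m) 1 = 0" unfolding psi_eq[OF m] by (simp add: poly_legendre_one)
qed

lemma degree_psi_le: assumes "m \<ge> 1" shows "degree (psi m) \<le> m + 1"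
proof -
  have "degree (legendre (m+1) - legendre (m-1)) \<le> m + 1"
    by (rule degree_diff_le) (auto simp: degree_legendre)
  thus ?thesis unfolding psi_eq[OF assms] by (rule order.trans[OF degree_smult_le])
qed

text \<open>The boundary terms disappear because psi_m vanishes at both ends. For p = phi_n this is
  the duality between the phi_n' and the psi_m; for an antiderivative p of some psi_n it expresses
  the coefficients of p by entries of M.\<close>

lemma l2ip_pderiv_psi: "m \<ge> 1 \<Longrightarrow> l2ip (pderiv p) (psi m) = - l2ip p (phi m)"
  by (simp add: l2ip_pderiv poly_psi_ends pderiv_psi)

text \<open>Only the L_{m+1} part of psi_m meets phi_{m+1}. These values later serve as pivots in a
  triangular system.\<close>

lemma l2ip_psi_phi_top: assumes "m \<ge> 1" shows "l2ip (psi m) (phi (m+1)) \<noteq> 0"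
proof -
  have "l2ip (legendre (m - 1)) (legendre (m+1)) = 0"
    by (subst l2ip_commute, rule l2ip_legendre_lower) (auto simp: degree_legendre)
  moreover have "sqrt (2 * (2 * real m + 1)) \<noteq> 0" "2 * real m + 1 \<noteq> 0" "2 * real m + 3 \<noteq> 0" by auto
  ultimately show ?thesis using assms
    by (simp add: psi_eq phi_def l2ip_smult_left l2ip_smult_right l2ip_diff_left l2ip_legendre_self del: legendre.simps)
qed

text \<open>There is one basis polynomial in each degree, so removing leading terms one by one
  yields some expansion; orthonormality then identifies its coefficients.\<close>

lemma phi_expansion: "degree p \<le> d \<Longrightarrow> p = (\<Sum>k\<le>d. Polynomial.smult (l2ip p (phi k)) (phi k))"
proof -
  have ex: "\<exists>c. p = (\<Sum>k\<le>d. Polynomial.smult (c k) (phi k))" if "degree p \<le> d" for p d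
    using that
  proof (induction d arbitrary: p)
    case 0
    have "phi 0 = [:sqrt (1/2):]" by (simp add: phi_def)
    moreover obtain a where "p = [:a:]" using 0 by (auto elim: degree_eq_zeroE)
    ultimately show ?case by (intro exI[of _ "\<lambda>_. a / sqrt (1/2)"]) simp
  next
    case (Suc d)
    define a where "a = coeff p (Suc d) / coeff (phi (Suc d)) (Suc d)"
    have ne: "coeff (phi (Suc d)) (Suc d) \<noteq> 0"
      using degree_phi[of "Suc d"] by (metis degree_0 leading_coeff_0_iff nat.distinct(1))
    let ?q = "p - Polynomial.smult a (phi (Suc d))"
    have "degree ?q \<le> d"
    proof (rule degree_le, intro allI impI)
      fix i assume "d < i"
      thus "coeff ?q i = 0"
        using Suc.prems degree_phi[of "Suc d"] ne
        by (cases "i = Suc d") (auto simp: a_def coeff_eq_0)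
    qed
    from Suc.IH[OF this] obtain c where c: "?q = (\<Sum>k\<le>d. Polynomial.smult (c k) (phi k))" ..
    hence "p = (\<Sum>k\<le>d. Polynomial.smult (c k) (phi k)) + Polynomial.smult a (phi (Suc d))"
      by (simp add: algebra_simps)
    hence "p = (\<Sum>k\<le>Suc d. Polynomial.smult ((c(Suc d := a)) k) (phi k))"
      by simp
    thus ?case by blast
  qed
  assume "degree p \<le> d"
  from ex[OF this] obtain c where c: "p = (\<Sum>k\<le>d. Polynomial.smult (c k) (phi k))" ..
  have "l2ip p (phi j) = c j" if "j \<le> d" for j
  proof -
    have "l2ip p (phi j) = (\<Sum>k\<le>d. c k * (if k = j then 1 else 0))"
      by (subst c) (simp add: l2ip_sum_left l2ip_smult_left phi_orthonormal)
    also have "\<dots> = c j" using that by (simp add: if_distrib cong: if_cong)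
    finally show ?thesis .
  qed
  thus ?thesis by (subst c) (auto intro!: sum.cong)
qed

text \<open>Expanding \<open>p\<close> is enough: its components stop at degree \<open>d\<close>, so
  those of \<open>q\<close> beyond \<open>d\<close> do not contribute.\<close>

lemma l2ip_parseval:
  assumes "degree p \<le> d"
  shows "l2ip p q = (\<Sum>k\<le>d. l2ip p (phi k) * l2ip q (phi k))"
  by (subst phi_expansion[OF assms], simp only: l2ip_sum_left l2ip_smult_left) (simp add: l2ip_commute)

lemma ex_antiderivative: "\<exists>q::real poly. pderiv q = p \<and> degree q \<le> degree p + 1"
proof -
  define q where "q = (\<Sum>i\<le>degree p. Polynomial.monom (coeff p i / real (Suc i)) (Suc i))"
  have "pderiv q = (\<Sum>i\<le>degree p. Polynomial.monom (coeff p i) i)"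
    unfolding q_def pderiv_sum by (intro sum.cong refl) (simp add: pderiv_monom del: of_nat_Suc)
  also have "\<dots> = p" by (rule poly_as_sum_of_monoms)
  finally have "pderiv q = p" .
  moreover have "degree q \<le> degree p + 1"
    unfolding q_def by (intro degree_sum_le) (auto intro: order.trans[OF degree_monom_le])
  ultimately show ?thesis by blast
qed

section \<open>Kronecker products\<close>

text \<open>The range is cut into \<open>n\<close> blocks of length \<open>m\<close>, on which
  quotient and remainder run independently. This turns a contraction over a Kronecker index into a
  double sum.\<close>

lemma sum_div_mod:
  fixes g :: "nat \<Rightarrow> nat \<Rightarrow> 'b :: comm_monoid_add"
  shows "(\<Sum>j<n*m. g (j div m) (j mod m)) = (\<Sum>p<n. \<Sum>q<m. g p q)"
proof (cases "m = 0")
  case False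
  have "(\<Sum>j<n*m. g (j div m) (j mod m)) = (\<Sum>p<n. \<Sum>j\<in>{p*m..<p*m+m}. g (j div m) (j mod m))"
    by (rule sum.nat_group[symmetric])
  also have "\<dots> = (\<Sum>p<n. \<Sum>q<m. g p q)"
  proof (rule sum.cong[OF refl])
    fix p
    have "(\<Sum>j\<in>{p*m..<p*m+m}. g (j div m) (j mod m)) = (\<Sum>q\<in>{0..<m}. g ((q + p*m) div m) ((q + p*m) mod m))"
      using sum.shift_bounds_nat_ivl[of "\<lambda>j. g (j div m) (j mod m)" 0 "p*m" m] by (simp add: add.commute)
    also have "\<dots> = (\<Sum>q<m. g p q)" using False by (auto simp: lessThan_atLeast0 intro!: sum.cong)
    finally show "(\<Sum>j\<in>{p*m..<p*m+m}. g (j div m) (j mod m)) = (\<Sum>q<m. g p q)" .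
  qed
  finally show ?thesis .
qed auto

lemma div_mod_less:
  assumes "(i::nat) < n * m"
  shows "i div m < n" "i mod m < m"
  using assms by (auto simp: less_mult_imp_div_less) (metis mod_less_divisor mult_0_right neq0_conv not_less0)

lemma mult_add_less:
  assumes "(i::nat) < n" "j < m"
  shows "i * m + j < n * m"
proof -
  have "i * m + j < Suc i * m" using assms(2) by simp
  also have "\<dots> \<le> n * m" using assms(1) by (intro mult_le_mono1) simp
  finally show ?thesis .
qed

lemma kron_carrier [simp]:
  "A \<in> carrier_mat a b \<Longrightarrow> B \<in> carrier_mat c d \<Longrightarrow> kron A B \<in> carrier_mat (a * c) (b * d)"
  by (auto simp: kron_def)

lemma kron_index:
  assumes "A \<in> carrier_mat a b" "B \<in> carrier_mat c d" "i < a * c" "j < b * d"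
  shows "kron A B $$ (i, j) = A $$ (i div c, j div d) * B $$ (i mod c, j mod d)"
  using assms by (auto simp: kron_def)

text \<open>The mixed-product rule: once the contracted index is split into quotient and remainder,
  the sum factors into one matrix product per slot.\<close>

lemma kron_mult:
  fixes A :: "'a :: comm_ring_1 mat"
  assumes A: "A \<in> carrier_mat a b" and B: "B \<in> carrier_mat c d"
    and C: "C \<in> carrier_mat b e" and D: "D \<in> carrier_mat d f"
  shows "kron A B * kron C D = kron (A * C) (B * D)"
proof (rule eq_matI)
  note AC = mult_carrier_mat[OF A C] and BD = mult_carrier_mat[OF B D]
  note KL = kron_carrier[OF A B] and KR = kron_carrier[OF C D] and K = kron_carrier[OF AC BD]
  show "dim_row (kron A B * kron C D) = dim_row (kron (A * C) (B * D))"
    "dim_col (kron A B * kron C D) = dim_col (kron (A * C) (B * D))" using KL KR K by auto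
  fix i j assume "i < dim_row (kron (A * C) (B * D))" "j < dim_col (kron (A * C) (B * D))"
  hence i: "i < a * c" and j: "j < e * f" using K by auto
  note ii = div_mod_less[OF i] and jj = div_mod_less[OF j]
  have "(kron A B * kron C D) $$ (i, j) = (\<Sum>k<b*d. kron A B $$ (i, k) * kron C D $$ (k, j))"
    using KL KR i j by (auto simp: scalar_prod_def lessThan_atLeast0 intro!: sum.cong)
  also have "\<dots> = (\<Sum>k<b*d. (A $$ (i div c, k div d) * C $$ (k div d, j div f)) *
      (B $$ (i mod c, k mod d) * D $$ (k mod d, j mod f)))"
    using i j by (intro sum.cong refl) (simp add: kron_index[OF A B] kron_index[OF C D] mult_ac)
  also have "\<dots> = (\<Sum>p<b. \<Sum>q<d. (A $$ (i div c, p) * C $$ (p, j div f)) * (B $$ (i mod c, q) * D $$ (q, j mod f)))"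
    by (rule sum_div_mod)
  also have "\<dots> = (\<Sum>p<b. A $$ (i div c, p) * C $$ (p, j div f)) * (\<Sum>q<d. B $$ (i mod c, q) * D $$ (q, j mod f))"
    by (simp only: sum_product)
  also have "\<dots> = (A * C) $$ (i div c, j div f) * (B * D) $$ (i mod c, j mod f)"
    using A B C D ii jj by (auto simp: scalar_prod_def lessThan_atLeast0 intro!: arg_cong2[where f = "(*)"] sum.cong)
  also have "\<dots> = kron (A * C) (B * D) $$ (i, j)"
    by (rule kron_index[OF AC BD i j, symmetric])
  finally show "(kron A B * kron C D) $$ (i, j) = kron (A * C) (B * D) $$ (i, j)" .
qed

lemma transpose_kron:
  "transpose_mat (kron A B) = kron (transpose_mat A) (transpose_mat B)"
  by (rule eq_matI) (auto simp: kron_def div_mod_less)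

lemma kron_one: "kron (1\<^sub>m a :: 'a :: comm_ring_1 mat) (1\<^sub>m b) = 1\<^sub>m (a * b)"
proof (rule eq_matI)
  fix i j assume "i < dim_row (1\<^sub>m (a * b) :: 'a mat)" "j < dim_col (1\<^sub>m (a * b) :: 'a mat)"
  hence i: "i < a * b" and j: "j < a * b" by auto
  have "(i = j) = (i div b = j div b \<and> i mod b = j mod b)" by (metis div_mult_mod_eq)
  thus "kron (1\<^sub>m a) (1\<^sub>m b) $$ (i, j) = (1\<^sub>m (a * b) :: 'a mat) $$ (i, j)"
    using i j div_mod_less[OF i] div_mod_less[OF j] by (simp add: kron_index[of _ a a _ b b])
qed (auto simp: kron_def)

lemma kron3_carrier [simp]:
  "A \<in> carrier_mat a a' \<Longrightarrow> B \<in> carrier_mat b b' \<Longrightarrow> C \<in> carrier_mat c c' \<Longrightarrow>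
    kron3 A B C \<in> carrier_mat (a * b * c) (a' * b' * c')"
  by (simp add: kron3_def)

lemma kron3_mult:
  fixes A :: "'a :: comm_ring_1 mat"
  assumes "A \<in> carrier_mat a a'" "B \<in> carrier_mat b b'" "C \<in> carrier_mat c c'"
    and "A' \<in> carrier_mat a' a''" "B' \<in> carrier_mat b' b''" "C' \<in> carrier_mat c' c''"
  shows "kron3 A B C * kron3 A' B' C' = kron3 (A * A') (B * B') (C * C')"
  using assms by (simp add: kron3_def kron_mult[of _ "a * b" "a' * b'" _ c c' _ "a'' * b''" _ c'']
      kron_mult[of _ a a' _ b b' _ a'' _ b''])

lemma transpose_kron3:
  "transpose_mat (kron3 A B C) = kron3 (transpose_mat A) (transpose_mat B) (transpose_mat C)"
  by (simp add: kron3_def transpose_kron)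

lemma kron3_one: "kron3 (1\<^sub>m a :: 'a :: comm_ring_1 mat) (1\<^sub>m b) (1\<^sub>m c) = 1\<^sub>m (a * b * c)"
  by (simp add: kron3_def kron_one)

lemma kron3_index:
  assumes "A \<in> carrier_mat a a'" "B \<in> carrier_mat b b'" "C \<in> carrier_mat c c'"
    and i: "i < a * b * c" and j: "j < a' * b' * c'"
  shows "kron3 A B C $$ (i, j) = A $$ (i div c div b, j div c' div b') * B $$ (i div c mod b, j div c' mod b') * C $$ (i mod c, j mod c')"
  using assms div_mod_less[OF i] div_mod_less[OF j]
  by (simp add: kron3_def kron_index[of _ "a*b" "a'*b'" _ c c'] kron_index[of _ a a' _ b b'])

text \<open>A vector of the triple tensor product is read as a three-dimensional array. Two uses of
  \<open>sum_div_mod\<close> split off the last index and then separate the first two.\<close>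

lemma kron3_mult_vec_index:
  fixes A :: "'a :: comm_ring_1 mat"
  assumes A: "A \<in> carrier_mat a a'" and B: "B \<in> carrier_mat b b'" and C: "C \<in> carrier_mat c c'"
    and z: "z \<in> carrier_vec (a' * b' * c')" and p: "p < a" and q: "q < b" and r: "r < c"
  shows "(kron3 A B C *\<^sub>v z) $ ((p * b + q) * c + r) =
    (\<Sum>p'<a'. \<Sum>q'<b'. \<Sum>r'<c'. A $$ (p, p') * B $$ (q, q') * C $$ (r, r') * z $ ((p' * b' + q') * c' + r'))"
proof -
  let ?i = "(p * b + q) * c + r"
  have "p * b + q < a * b" using p q by (rule mult_add_less)
  hence i: "?i < a * b * c" using r by (rule mult_add_less)
  have idx: "?i div c div b = p" "?i div c mod b = q" "?i mod c = r" using p q r by auto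
  let ?g = "\<lambda>p' q' r'. A $$ (p, p') * B $$ (q, q') * C $$ (r, r') * z $ ((p' * b' + q') * c' + r')"
  have "(kron3 A B C *\<^sub>v z) $ ?i = (\<Sum>j<a'*b'*c'. kron3 A B C $$ (?i, j) * z $ j)"
    using kron3_carrier[OF A B C] i z by (auto simp: scalar_prod_def lessThan_atLeast0 intro!: sum.cong)
  also have "\<dots> = (\<Sum>j<a'*b'*c'. ?g (j div c' div b') (j div c' mod b') (j mod c'))"
    using i by (intro sum.cong refl) (simp add: kron3_index[OF A B C] idx r)
  also have "\<dots> = (\<Sum>k<a'*b'. \<Sum>r'<c'. ?g (k div b') (k mod b') r')"
    by (rule sum_div_mod)
  also have "\<dots> = (\<Sum>p'<a'. \<Sum>q'<b'. \<Sum>r'<c'. ?g p' q' r')"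
    by (rule sum_div_mod)
  finally show ?thesis .
qed

section \<open>Kernels cut out by vanishing coordinates\<close>

text \<open>The unit vectors with index in \<open>J\<close> form a basis of the kernel.\<close>

lemma kernel_dim_coordinate_subspace:
  fixes A :: "'a :: field mat"
  assumes A: "A \<in> carrier_mat nr n" and J: "J \<subseteq> {..<n}"
    and ker: "mat_kernel A = {v \<in> carrier_vec n. \<forall>i<n. i \<notin> J \<longrightarrow> v $ i = 0}"
  shows "kernel_dim A = card J"
proof -
  interpret kernel nr n A by unfold_locales (rule A)
  let ?B = "unit_vec n ` J :: 'a vec set"
  have finJ: "finite J" using J finite_subset by blast
  have inj: "inj_on (unit_vec n :: nat \<Rightarrow> 'a vec) J"
    using J by (intro inj_onI) (metis index_unit_vec(1) index_unit_vec(2) lessThan_iff subsetD zero_neq_one)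
  have Bk: "?B \<subseteq> mat_kernel A" using J by (auto simp: ker)
  have "?B \<subseteq> set (unit_vecs n)" using J by (auto simp: unit_vecs_def)
  \<comment> \<open>Independence comes from the standard basis of the ambient space;
    \<open>lindep_same\<close> then transfers it to the kernel as a space of its own.\<close>
  hence "NC.lin_indpt ?B" using NC.unit_vecs_basis NC.subset_li_is_li unfolding NC.basis_def by blast
  hence li: "Ker.lin_indpt ?B" using lindep_same[OF Bk] by simp
  have "span ?B = mat_kernel A"
  proof
    show "span ?B \<subseteq> mat_kernel A" using Bk by (rule Ker.span_is_subset2)
    show "mat_kernel A \<subseteq> span ?B"
    proof
      fix v assume v: "v \<in> mat_kernel A"
      hence vc: "v \<in> carrier_vec n" by (simp add: ker)
      \<comment> \<open>The scalar product with \<open>unit_vec n j\<close> reads off coordinate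
        \<open>j\<close>, so these coefficients reproduce \<open>v\<close> on \<open>J\<close>;
        outside \<open>J\<close> both sides are zero.\<close>
      have "v = lincomb (\<lambda>b. v \<bullet> b) ?B"
      proof (rule eq_vecI)
        have "lincomb (\<lambda>b. v \<bullet> b) ?B \<in> carrier_vec n"
          using Ker.lincomb_closed[OF Bk] by (auto simp: ker)
        thus "dim_vec v = dim_vec (lincomb (\<lambda>b. v \<bullet> b) ?B)" using vc by simp
        fix i assume "i < dim_vec (lincomb (\<lambda>b. v \<bullet> b) ?B)"
        hence i: "i < n" using \<open>lincomb (\<lambda>b. v \<bullet> b) ?B \<in> carrier_vec n\<close> by simp
        have "lincomb (\<lambda>b. v \<bullet> b) ?B $ i = (\<Sum>j\<in>J. (v \<bullet> unit_vec n j) * unit_vec n j $ i)"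
          by (simp add: lincomb_index[OF i Bk] sum.reindex[OF inj])
        also have "\<dots> = (\<Sum>j\<in>J. if j = i then v $ i else 0)"
          using J i vc by (intro sum.cong) (auto simp: scalar_prod_right_unit)
        also have "\<dots> = v $ i" using v i finJ by (auto simp: ker)
        finally show "v $ i = lincomb (\<lambda>b. v \<bullet> b) ?B $ i" ..
      qed
      thus "v \<in> span ?B" unfolding Ker.span_def using finJ by blast
    qed
  qed
  hence "Ker.basis ?B" using li Bk by (simp add: Ker.basis_def)
  hence "dim = card ?B" using finJ by (intro Ker.dim_basis) auto
  thus ?thesis by (simp add: card_image[OF inj])
qed

section \<open>Gram matrices and sums of squares\<close>

text \<open>Semidefiniteness in the form in which it is applied: that a zero of the quadratic form
  lies in the kernel, which for symmetric matrices follows from nonnegativity, is built in.\<close>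

definition psd :: "nat \<Rightarrow> real mat \<Rightarrow> bool" where
  "psd n G \<longleftrightarrow> G \<in> carrier_mat n n \<and>
     (\<forall>v \<in> carrier_vec n. v \<bullet> (G *\<^sub>v v) \<ge> 0 \<and> (v \<bullet> (G *\<^sub>v v) = 0 \<longrightarrow> G *\<^sub>v v = 0\<^sub>v n))"

lemma scalar_prod_self_real:
  fixes v :: "real vec"
  shows "v \<bullet> v \<ge> 0" "v \<bullet> v = 0 \<Longrightarrow> v = 0\<^sub>v (dim_vec v)"
proof -
  show "v \<bullet> v \<ge> 0" by (auto simp: scalar_prod_def intro!: sum_nonneg)
  assume "v \<bullet> v = 0"
  hence "\<forall>i\<in>{0..<dim_vec v}. v $ i * v $ i = 0"
    unfolding scalar_prod_def by (subst (asm) sum_nonneg_eq_0_iff) auto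
  thus "v = 0\<^sub>v (dim_vec v)" by (intro eq_vecI) auto
qed

text \<open>The quadratic form at v is |X v|^2, and if it vanishes, so does X v.\<close>

lemma psd_gram:
  assumes X: "X \<in> carrier_mat r n"
  shows "psd n (transpose_mat X * X)"
proof -
  have "v \<bullet> (transpose_mat X * X *\<^sub>v v) = (X *\<^sub>v v) \<bullet> (X *\<^sub>v v)" if v: "v \<in> carrier_vec n" for v
  proof -
    have Xv: "X *\<^sub>v v \<in> carrier_vec r" using X v by simp
    have "v \<bullet> (transpose_mat X * X *\<^sub>v v) = v \<bullet> (transpose_mat X *\<^sub>v (X *\<^sub>v v))"
      using X v by (subst assoc_mult_mat_vec[of _ n r _ n]) auto
    also have "\<dots> = (transpose_mat (transpose_mat X) *\<^sub>v v) \<bullet> (X *\<^sub>v v)"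
      using X v Xv by (subst transpose_vec_mult_scalar[of _ n r, symmetric]) (auto simp: comm_scalar_prod[of _ n])
    finally show ?thesis by simp
  qed
  moreover have "transpose_mat X * X *\<^sub>v v = 0\<^sub>v n"
    if v: "v \<in> carrier_vec n" and 0: "(X *\<^sub>v v) \<bullet> (X *\<^sub>v v) = 0" for v
  proof -
    have "X *\<^sub>v v = 0\<^sub>v r" using scalar_prod_self_real(2)[OF 0] X by simp
    moreover have "transpose_mat X * X *\<^sub>v v = transpose_mat X *\<^sub>v (X *\<^sub>v v)"
      using X v by (intro assoc_mult_mat_vec[of _ n r _ n]) auto
    moreover have "transpose_mat X *\<^sub>v 0\<^sub>v r = 0\<^sub>v n" using X by (intro eq_vecI) auto
    ultimately show ?thesis by simp
  qed
  moreover have "transpose_mat X * X \<in> carrier_mat n n" using X by simp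
  ultimately show ?thesis unfolding psd_def by (simp add: scalar_prod_self_real(1))
qed

text \<open>By the mixed-product rule a Kronecker product of Gram matrices is the Gram matrix of the
  Kronecker product of their factors.\<close>

lemma psd_kron3_gram:
  assumes X: "X \<in> carrier_mat a n" and Y: "Y \<in> carrier_mat b n" and Z: "Z \<in> carrier_mat c n"
  shows "psd (n * n * n) (kron3 (transpose_mat X * X) (transpose_mat Y * Y) (transpose_mat Z * Z))"
proof -
  have "kron3 (transpose_mat X * X) (transpose_mat Y * Y) (transpose_mat Z * Z)
      = transpose_mat (kron3 X Y Z) * kron3 X Y Z"
    unfolding transpose_kron3 using X Y Z
    by (intro kron3_mult[symmetric, of _ n a _ n b _ n c _ n _ n _ n]) auto
  thus ?thesis using psd_gram[OF kron3_carrier[OF X Y Z]] by simp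
qed

text \<open>Pairing the first equation with \<open>u\<close>, the second with \<open>w\<close>, and
  adding writes zero as a sum of six nonnegative forms, each of which must therefore vanish.\<close>

lemma psd_block_kernel:
  assumes psd: "psd n G1" "psd n G2" "psd n G3" "psd n G4" "psd n H1" "psd n H3"
    and u: "u \<in> carrier_vec n" and w: "w \<in> carrier_vec n"
    and e1: "(G1 + G2 + G3 + G4) *\<^sub>v u + (G2 + G4) *\<^sub>v w = 0\<^sub>v n"
    and e2: "(G2 + G4) *\<^sub>v u + (H1 + G2 + H3 + G4) *\<^sub>v w = 0\<^sub>v n"
  shows "G1 *\<^sub>v u = 0\<^sub>v n" "G3 *\<^sub>v u = 0\<^sub>v n" "H1 *\<^sub>v w = 0\<^sub>v n" "H3 *\<^sub>v w = 0\<^sub>v n"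
    "G2 *\<^sub>v (u + w) = 0\<^sub>v n" "G4 *\<^sub>v (u + w) = 0\<^sub>v n"
proof -
  have c: "G1 \<in> carrier_mat n n" "G2 \<in> carrier_mat n n" "G3 \<in> carrier_mat n n" "G4 \<in> carrier_mat n n"
    "H1 \<in> carrier_mat n n" "H3 \<in> carrier_mat n n" using psd by (auto simp: psd_def)
  have cv: "G *\<^sub>v x \<in> carrier_vec n" if "G \<in> carrier_mat n n" for G :: "real mat" and x
    using carrier_matD(1)[OF that] by (intro carrier_vecI) simp
  define q where "q = (\<lambda>G x y :: real vec. x \<bullet> ((G :: real mat) *\<^sub>v y))"
  have q_add: "q (G + H) x y = q G x y + q H x y"
    if "G \<in> carrier_mat n n" "H \<in> carrier_mat n n" "x \<in> carrier_vec n" "y \<in> carrier_vec n" for G H x y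
    using that by (simp add: q_def add_mult_distrib_mat_vec[of _ n n] scalar_prod_add_distrib[of _ n])
  have q_sum: "q G (u + w) (u + w) = q G u u + q G u w + q G w u + q G w w" if "G \<in> carrier_mat n n" for G
    using that u w cv[OF that]
    by (simp add: q_def mult_add_distrib_mat_vec[of _ n n] scalar_prod_add_distrib[of _ n] add_scalar_prod_distrib[of _ n])
  have cs: "G1 + G2 + G3 + G4 \<in> carrier_mat n n" "G2 + G4 \<in> carrier_mat n n" "H1 + G2 + H3 + G4 \<in> carrier_mat n n"
    using c by auto
  have "u \<bullet> ((G1 + G2 + G3 + G4) *\<^sub>v u + (G2 + G4) *\<^sub>v w) + w \<bullet> ((G2 + G4) *\<^sub>v u + (H1 + G2 + H3 + G4) *\<^sub>v w) = 0"
    unfolding e1 e2 using u w by simp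
  moreover have "u \<bullet> ((G1 + G2 + G3 + G4) *\<^sub>v u + (G2 + G4) *\<^sub>v w) = q (G1 + G2 + G3 + G4) u u + q (G2 + G4) u w"
    unfolding q_def by (rule scalar_prod_add_distrib[OF u cv[OF cs(1)] cv[OF cs(2)]])
  moreover have "w \<bullet> ((G2 + G4) *\<^sub>v u + (H1 + G2 + H3 + G4) *\<^sub>v w) = q (G2 + G4) w u + q (H1 + G2 + H3 + G4) w w"
    unfolding q_def by (rule scalar_prod_add_distrib[OF w cv[OF cs(2)] cv[OF cs(3)]])
  ultimately have "q (G1 + G2 + G3 + G4) u u + q (G2 + G4) u w + q (G2 + G4) w u + q (H1 + G2 + H3 + G4) w w = 0"
    by simp
  \<comment> \<open>\<open>G2\<close> and \<open>G4\<close> occur in all four blocks, so their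
    diagonal and mixed terms assemble to their forms at \<open>u + w\<close>.\<close>
  hence "q G1 u u + q G3 u u + q H1 w w + q H3 w w + q G2 (u + w) (u + w) + q G4 (u + w) (u + w) = 0"
    using c u w by (simp add: q_add q_sum)
  moreover have ge: "q G x x \<ge> 0" if "psd n G" "x \<in> carrier_vec n" for G x
    using that by (simp add: psd_def q_def)
  moreover have uw: "u + w \<in> carrier_vec n" using u w by simp
  note ges = ge[OF psd(1) u] ge[OF psd(3) u] ge[OF psd(5) w] ge[OF psd(6) w] ge[OF psd(2) uw] ge[OF psd(4) uw]
  ultimately have "q G1 u u = 0" "q G3 u u = 0" "q H1 w w = 0" "q H3 w w = 0" "q G2 (u + w) (u + w) = 0" "q G4 (u + w) (u + w) = 0"
    using ges by linarith+
  thus "G1 *\<^sub>v u = 0\<^sub>v n" "G3 *\<^sub>v u = 0\<^sub>v n" "H1 *\<^sub>v w = 0\<^sub>v n" "H3 *\<^sub>v w = 0\<^sub>v n"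
    "G2 *\<^sub>v (u + w) = 0\<^sub>v n" "G4 *\<^sub>v (u + w) = 0\<^sub>v n"
    using psd u w uw by (simp_all add: psd_def q_def)
qed

section \<open>Matrices acting in one tensor slot\<close>

text \<open>The product factors as the part acting by \<open>Y\<close> and \<open>Z\<close>, times
  the part acting by \<open>A\<close> alone. The left factor has a left inverse and so does not
  change the kernel.\<close>

lemma mat_kernel_kron3_slots:
  fixes A :: "'a :: comm_ring_1 mat"
  assumes A: "A \<in> carrier_mat n n"
    and Y: "Y \<in> carrier_mat n n" and Y': "Y' \<in> carrier_mat n n" and YY: "Y' * Y = 1\<^sub>m n"
    and Z: "Z \<in> carrier_mat n n" and Z': "Z' \<in> carrier_mat n n" and ZZ: "Z' * Z = 1\<^sub>m n"
  shows "mat_kernel (kron3 A Y Z) = mat_kernel (kron3 A (1\<^sub>m n) (1\<^sub>m n))"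
    "mat_kernel (kron3 Y A Z) = mat_kernel (kron3 (1\<^sub>m n) A (1\<^sub>m n))"
    "mat_kernel (kron3 Y Z A) = mat_kernel (kron3 (1\<^sub>m n) (1\<^sub>m n) A)"
proof -
  let ?I = "1\<^sub>m n :: 'a mat"
  have I: "?I \<in> carrier_mat n n" by simp
  note m = kron3_mult[of _ n n _ n n _ n n _ n _ n _ n]
  have "mat_kernel (kron3 ?I Y Z * kron3 A ?I ?I) = mat_kernel (kron3 A ?I ?I)"
    using A Y Y' Z Z'
    by (intro mat_kernel_mult_eq[where C = "kron3 ?I Y' Z'" and nr = "n * n * n" and nc = "n * n * n"]) (auto simp: m YY ZZ kron3_one)
  thus "mat_kernel (kron3 A Y Z) = mat_kernel (kron3 A ?I ?I)" using A Y Z by (simp add: m)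
  have "mat_kernel (kron3 Y ?I Z * kron3 ?I A ?I) = mat_kernel (kron3 ?I A ?I)"
    using A Y Y' Z Z'
    by (intro mat_kernel_mult_eq[where C = "kron3 Y' ?I Z'" and nr = "n * n * n" and nc = "n * n * n"]) (auto simp: m YY ZZ kron3_one)
  thus "mat_kernel (kron3 Y A Z) = mat_kernel (kron3 ?I A ?I)" using A Y Z by (simp add: m)
  have "mat_kernel (kron3 Y Z ?I * kron3 ?I ?I A) = mat_kernel (kron3 ?I ?I A)"
    using A Y Y' Z Z'
    by (intro mat_kernel_mult_eq[where C = "kron3 Y' Z' ?I" and nr = "n * n * n" and nc = "n * n * n"]) (auto simp: m YY ZZ kron3_one)
  thus "mat_kernel (kron3 Y Z A) = mat_kernel (kron3 ?I ?I A)" using A Y Z by (simp add: m)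
qed

lemma vec_eq_zero_iff3:
  assumes "x \<in> carrier_vec (n * n * n)"
  shows "x = 0\<^sub>v (n * n * n) \<longleftrightarrow> (\<forall>a<n. \<forall>b<n. \<forall>c<n. x $ ((a * n + b) * n + c) = 0)"
proof
  assume "x = 0\<^sub>v (n * n * n)"
  thus "\<forall>a<n. \<forall>b<n. \<forall>c<n. x $ ((a * n + b) * n + c) = 0" by (simp add: mult_add_less)
next
  assume *: "\<forall>a<n. \<forall>b<n. \<forall>c<n. x $ ((a * n + b) * n + c) = 0"
  show "x = 0\<^sub>v (n * n * n)"
  proof (rule eq_vecI)
    fix i assume "i < dim_vec (0\<^sub>v (n * n * n) :: 'a vec)"
    hence i: "i < n * n * n" by simp
    have "x $ ((i div n div n * n + i div n mod n) * n + i mod n) = 0"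
      using * div_mod_less[OF i] div_mod_less[OF div_mod_less(1)[OF i]] by blast
    thus "x $ i = 0\<^sub>v (n * n * n) $ i" using i by simp
  qed (use assms in simp)
qed

text \<open>A matrix in one slot acts separately on every line of the array in that direction, so
  its kernel is described line by line by the kernel of \<open>X\<close>.\<close>

lemma kron3_slot_zero_iff:
  fixes X :: "'a :: comm_ring_1 mat"
  assumes X: "X \<in> carrier_mat n n" and z: "z \<in> carrier_vec (n * n * n)"
    and T: "\<And>y. y \<in> carrier_vec n \<Longrightarrow> X *\<^sub>v y = 0\<^sub>v n \<longleftrightarrow> (\<forall>a<n. a \<in> T \<longrightarrow> y $ a = 0)"
  shows "kron3 X (1\<^sub>m n) (1\<^sub>m n) *\<^sub>v z = 0\<^sub>v (n * n * n) \<longleftrightarrow>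
      (\<forall>a<n. \<forall>b<n. \<forall>c<n. a \<in> T \<longrightarrow> z $ ((a * n + b) * n + c) = 0)" (is ?t1)
    and "kron3 (1\<^sub>m n) X (1\<^sub>m n) *\<^sub>v z = 0\<^sub>v (n * n * n) \<longleftrightarrow>
      (\<forall>a<n. \<forall>b<n. \<forall>c<n. b \<in> T \<longrightarrow> z $ ((a * n + b) * n + c) = 0)" (is ?t2)
    and "kron3 (1\<^sub>m n) (1\<^sub>m n) X *\<^sub>v z = 0\<^sub>v (n * n * n) \<longleftrightarrow>
      (\<forall>a<n. \<forall>b<n. \<forall>c<n. c \<in> T \<longrightarrow> z $ ((a * n + b) * n + c) = 0)" (is ?t3)
proof -
  have I: "(1\<^sub>m n :: 'a mat) \<in> carrier_mat n n" by simp
  have slice: "(\<forall>a<n. (\<Sum>p<n. X $$ (a, p) * f p) = 0) \<longleftrightarrow> (\<forall>a<n. a \<in> T \<longrightarrow> f a = 0)" for f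
  proof -
    have "(\<forall>a<n. (\<Sum>p<n. X $$ (a, p) * f p) = 0) \<longleftrightarrow> X *\<^sub>v Matrix.vec n f = 0\<^sub>v n"
      using X by (auto simp: vec_eq_iff scalar_prod_def lessThan_atLeast0)
    thus ?thesis using T[of "Matrix.vec n f"] by simp
  qed
  have delta: "(\<Sum>q<n. 1\<^sub>m n $$ (b, q) * f q) = f b" if "b < n" for b and f :: "nat \<Rightarrow> 'a"
  proof -
    have "(\<Sum>q<n. 1\<^sub>m n $$ (b, q) * f q) = (\<Sum>q<n. if b = q then f q else 0)"
      using that by (intro sum.cong) auto
    thus ?thesis using that by simp
  qed
  have e1: "(kron3 X (1\<^sub>m n) (1\<^sub>m n) *\<^sub>v z) $ ((a * n + b) * n + c) = (\<Sum>p<n. X $$ (a, p) * z $ ((p * n + b) * n + c))"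
    if "a < n" "b < n" "c < n" for a b c
    unfolding kron3_mult_vec_index[OF X I I z that]
    using that by (simp only: mult.assoc sum_distrib_left[symmetric] delta)
  have e2: "(kron3 (1\<^sub>m n) X (1\<^sub>m n) *\<^sub>v z) $ ((a * n + b) * n + c) = (\<Sum>p<n. X $$ (b, p) * z $ ((a * n + p) * n + c))"
    if "a < n" "b < n" "c < n" for a b c
    unfolding kron3_mult_vec_index[OF I X I z that]
    using that by (simp only: mult.assoc sum_distrib_left[symmetric] delta)
  have e3: "(kron3 (1\<^sub>m n) (1\<^sub>m n) X *\<^sub>v z) $ ((a * n + b) * n + c) = (\<Sum>p<n. X $$ (c, p) * z $ ((a * n + b) * n + p))"
    if "a < n" "b < n" "c < n" for a b c
    unfolding kron3_mult_vec_index[OF I I X z that]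
    using that by (simp only: mult.assoc sum_distrib_left[symmetric] delta)
  have c: "kron3 X (1\<^sub>m n) (1\<^sub>m n) *\<^sub>v z \<in> carrier_vec (n * n * n)"
    "kron3 (1\<^sub>m n) X (1\<^sub>m n) *\<^sub>v z \<in> carrier_vec (n * n * n)"
    "kron3 (1\<^sub>m n) (1\<^sub>m n) X *\<^sub>v z \<in> carrier_vec (n * n * n)"
    using mult_mat_vec_carrier[OF kron3_carrier[OF X I I] z] mult_mat_vec_carrier[OF kron3_carrier[OF I X I] z]
      mult_mat_vec_carrier[OF kron3_carrier[OF I I X] z] by auto
  \<comment> \<open>The index of the active slot is quantified innermost, so that
    \<open>slice\<close> applies to one line at a time; likewise for the other two slots.\<close>
  have "kron3 X (1\<^sub>m n) (1\<^sub>m n) *\<^sub>v z = 0\<^sub>v (n * n * n) \<longleftrightarrow> (\<forall>b<n. \<forall>c<n. \<forall>a<n. (\<Sum>p<n. X $$ (a, p) * z $ ((p * n + b) * n + c)) = 0)"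
    unfolding vec_eq_zero_iff3[OF c(1)] by (auto simp: e1)
  also have "\<dots> \<longleftrightarrow> (\<forall>b<n. \<forall>c<n. \<forall>a<n. a \<in> T \<longrightarrow> z $ ((a * n + b) * n + c) = 0)"
    by (simp only: slice)
  finally show ?t1 by blast
  have "kron3 (1\<^sub>m n) X (1\<^sub>m n) *\<^sub>v z = 0\<^sub>v (n * n * n) \<longleftrightarrow> (\<forall>a<n. \<forall>c<n. \<forall>b<n. (\<Sum>p<n. X $$ (b, p) * z $ ((a * n + p) * n + c)) = 0)"
    unfolding vec_eq_zero_iff3[OF c(2)] by (auto simp: e2)
  also have "\<dots> \<longleftrightarrow> (\<forall>a<n. \<forall>c<n. \<forall>b<n. b \<in> T \<longrightarrow> z $ ((a * n + b) * n + c) = 0)"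
    by (simp only: slice)
  finally show ?t2 by blast
  have "kron3 (1\<^sub>m n) (1\<^sub>m n) X *\<^sub>v z = 0\<^sub>v (n * n * n) \<longleftrightarrow> (\<forall>a<n. \<forall>b<n. \<forall>c<n. (\<Sum>p<n. X $$ (c, p) * z $ ((a * n + b) * n + p)) = 0)"
    unfolding vec_eq_zero_iff3[OF c(3)] by (auto simp: e3)
  also have "\<dots> \<longleftrightarrow> (\<forall>a<n. \<forall>b<n. \<forall>c<n. c \<in> T \<longrightarrow> z $ ((a * n + b) * n + c) = 0)"
    by (simp only: slice)
  finally show ?t3 by blast
qed

section \<open>Mass and stiffness matrices\<close>

text \<open>Column j belongs to \<open>f (j + 1)\<close>, the index shift of \<open>massM\<close>
  and \<open>stiffS\<close>; the \<open>Suc d\<close> rows are the coordinates along phi_0, ...,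
  phi_d.\<close>

definition phi_coords :: "nat \<Rightarrow> nat \<Rightarrow> (nat \<Rightarrow> real poly) \<Rightarrow> real mat" where
  "phi_coords d n f = mat (Suc d) n (\<lambda>(k, j). l2ip (f (j + 1)) (phi k))"

lemma phi_coords_carrier [simp]: "phi_coords d n f \<in> carrier_mat (Suc d) n"
  by (simp add: phi_coords_def)

lemma gram_phi_coords:
  assumes "\<And>j. j < n \<Longrightarrow> degree (f (j + 1)) \<le> d"
  shows "transpose_mat (phi_coords d n f) * phi_coords d n g = mat n n (\<lambda>(i, j). l2ip (f (i + 1)) (g (j + 1)))"
proof (rule eq_matI)
  fix i j assume "i < dim_row (mat n n (\<lambda>(i, j). l2ip (f (i + 1)) (g (j + 1))))"
    "j < dim_col (mat n n (\<lambda>(i, j). l2ip (f (i + 1)) (g (j + 1))))"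
  hence ij: "i < n" "j < n" by auto
  have "{0..<Suc d} = {..d}" by auto
  thus "(transpose_mat (phi_coords d n f) * phi_coords d n g) $$ (i, j) = mat n n (\<lambda>(i, j). l2ip (f (i + 1)) (g (j + 1))) $$ (i, j)"
    using ij l2ip_parseval[OF assms[OF ij(1)], of "g (j + 1)"]
    by (simp add: phi_coords_def scalar_prod_def)
qed (auto simp: phi_coords_def)

text \<open>An antiderivative of psi_m has degree at most m + 2, hence at most d; differentiating
  its expansion in the phi_k writes psi_m as a combination of the phi_k'. In matrix terms, the
  corresponding column of G M + H is zero.\<close>

lemma psi_eq_sum_pderiv_phi:
  assumes "m \<ge> 1" "m + 2 \<le> d"
  shows "psi m = - (\<Sum>k<d. Polynomial.smult (l2ip (psi m) (psi (k + 1))) (pderiv (phi (k + 1))))"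
proof -
  obtain q where q: "pderiv q = psi m" "degree q \<le> degree (psi m) + 1"
    using ex_antiderivative by blast
  hence "degree q \<le> d" using degree_psi_le[OF assms(1)] assms(2) by simp
  have "psi m = pderiv (\<Sum>k\<le>d. Polynomial.smult (l2ip q (phi k)) (phi k))"
    using phi_expansion[OF \<open>degree q \<le> d\<close>] q(1) by simp
  also have "\<dots> = (\<Sum>k\<le>d. Polynomial.smult (l2ip q (phi k)) (pderiv (phi k)))"
    by (simp add: pderiv_sum pderiv_smult)
  \<comment> \<open>The summand for k = 0 drops out because phi_0 is constant.\<close>
  also have "\<dots> = (\<Sum>k<d. Polynomial.smult (l2ip q (phi (k + 1))) (pderiv (phi (k + 1))))"
    by (subst sum.atMost_shift) (simp add: phi_def pderiv_smult lessThan_atLeast0)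
  also have "\<dots> = (\<Sum>k<d. - Polynomial.smult (l2ip (psi m) (psi (k + 1))) (pderiv (phi (k + 1))))"
    using l2ip_pderiv_psi[of _ q] by (simp add: q(1))
  finally show ?thesis by (simp add: sum_negf)
qed

text \<open>\<open>mat_inverse\<close> returns an option; a two-sided inverse excludes
  \<open>None\<close>, so that \<open>the\<close> in \<open>mat_inv\<close> yields a genuine
  inverse.\<close>

lemma mat_inv:
  assumes "A \<in> carrier_mat n n" "B \<in> carrier_mat n n" "A * B = 1\<^sub>m n" "B * A = 1\<^sub>m n"
  shows "mat_inv A \<in> carrier_mat n n" "A * mat_inv A = 1\<^sub>m n" "mat_inv A * A = 1\<^sub>m n"
proof -
  have "A \<in> Units (ring_mat TYPE(real) n ())"
    using assms by (auto simp: Units_def ring_mat_def)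
  then obtain C where "mat_inverse A = Some C"
    using mat_inverse(1)[OF assms(1), where b = "()"] by (cases "mat_inverse A") auto
  thus "mat_inv A \<in> carrier_mat n n" "A * mat_inv A = 1\<^sub>m n" "mat_inv A * A = 1\<^sub>m n"
    using mat_inverse(2)[OF assms(1)] by (auto simp: mat_inv_def)
qed

text \<open>Pairing X^T X v with v gives |X v|^2.\<close>

lemma gram_mult_vec_zero:
  fixes X :: "real mat"
  assumes X: "X \<in> carrier_mat r n" and v: "v \<in> carrier_vec n"
  shows "transpose_mat X * X *\<^sub>v v = 0\<^sub>v n \<longleftrightarrow> X *\<^sub>v v = 0\<^sub>v r"
proof
  have e: "transpose_mat X * X *\<^sub>v v = transpose_mat X *\<^sub>v (X *\<^sub>v v)"
    using X v by (intro assoc_mult_mat_vec[of _ n r _ n]) auto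
  assume "transpose_mat X * X *\<^sub>v v = 0\<^sub>v n"
  hence "(transpose_mat X *\<^sub>v (X *\<^sub>v v)) \<bullet> v = 0" using e v by simp
  hence "(X *\<^sub>v v) \<bullet> (X *\<^sub>v v) = 0"
    using X v by (subst (asm) transpose_vec_mult_scalar[of _ r n]) auto
  thus "X *\<^sub>v v = 0\<^sub>v r" using scalar_prod_self_real(2) X by force
next
  have e: "transpose_mat X * X *\<^sub>v v = transpose_mat X *\<^sub>v (X *\<^sub>v v)"
    using X v by (intro assoc_mult_mat_vec[of _ n r _ n]) auto
  assume "X *\<^sub>v v = 0\<^sub>v r"
  thus "transpose_mat X * X *\<^sub>v v = 0\<^sub>v n" unfolding e using X by (intro eq_vecI) auto
qed

lemma mult_mat_vec_eq_zero_iff: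
  fixes A :: "'a :: comm_ring_1 mat"
  assumes "A \<in> carrier_mat r n" "y \<in> carrier_vec n"
  shows "A *\<^sub>v y = 0\<^sub>v r \<longleftrightarrow> (\<forall>k<r. (\<Sum>j<n. A $$ (k, j) * y $ j) = 0)"
  using assms by (auto simp: vec_eq_iff scalar_prod_def lessThan_atLeast0)

text \<open>The one-dimensional input of the tensor argument. The N + 1 rows of \<open>H\<close> and
  \<open>R\<close> stand for the degrees 0 to N, and \<open>{N-3..}\<close> selects the last two of
  the positions 0, ..., N - 2.\<close>

lemma mass_stiffness_defect:
  assumes N: "N \<ge> 4"
  obtains H R where "H \<in> carrier_mat (N + 1) (N - 1)" "R \<in> carrier_mat (N + 1) (N - 1)"
    "massM N = transpose_mat H * H"
    "mat_inv (massM N) \<in> carrier_mat (N - 1) (N - 1)"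
    "massM N * mat_inv (massM N) = 1\<^sub>m (N - 1)" "mat_inv (massM N) * massM N = 1\<^sub>m (N - 1)"
    "stiffS N = mat_inv (massM N) + transpose_mat R * R"
    "\<And>y. y \<in> carrier_vec (N - 1) \<Longrightarrow>
      (transpose_mat R * R * massM N) *\<^sub>v y = 0\<^sub>v (N - 1) \<longleftrightarrow> (\<forall>a<N-1. a \<in> {N-3..} \<longrightarrow> y $ a = 0)"
proof -
  define n where "n = N - 1"
  \<comment> \<open>The degrees of the psi_m with m < N are at most N, so coordinates up to phi_N
    represent them, and the phi_m', exactly.\<close>
  define H where "H = phi_coords N n psi"
  define G where "G = phi_coords N n (\<lambda>j. pderiv (phi j))"
  define M where "M = massM N"
  have Hc: "H \<in> carrier_mat (N + 1) n" and Gc: "G \<in> carrier_mat (N + 1) n" by (auto simp: H_def G_def)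
  have dpsi: "degree (psi (j + 1)) \<le> N" if "j < n" for j
    using degree_psi_le[of "j + 1"] that by (simp add: n_def)
  have dphi: "degree (pderiv (phi (j + 1))) \<le> N" if "j < n" for j
    using that by (simp add: degree_pderiv degree_phi n_def)
  have MH: "M = transpose_mat H * H"
  proof -
    have "transpose_mat H * H = mat n n (\<lambda>(i, j). l2ip (psi (i + 1)) (psi (j + 1)))"
      unfolding H_def by (rule gram_phi_coords) (rule dpsi)
    thus ?thesis by (auto simp: M_def massM_def n_def l2ip_commute)
  qed
  have SG: "stiffS N = transpose_mat G * G"
  proof -
    have "transpose_mat G * G = mat n n (\<lambda>(i, j). l2ip (pderiv (phi (i + 1))) (pderiv (phi (j + 1))))"
      unfolding G_def by (rule gram_phi_coords) (rule dphi)
    thus ?thesis by (auto simp: stiffS_def n_def l2ip_commute)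
  qed
  have GH: "transpose_mat G * H = - 1\<^sub>m n"
  proof -
    have "transpose_mat G * H = mat n n (\<lambda>(i, j). l2ip (pderiv (phi (i + 1))) (psi (j + 1)))"
      unfolding G_def H_def by (rule gram_phi_coords) (rule dphi)
    also have "\<dots> = - 1\<^sub>m n"
      by (rule eq_matI) (auto simp: l2ip_pderiv_psi phi_orthonormal)
    finally show ?thesis .
  qed
  have HG: "transpose_mat H * G = - 1\<^sub>m n"
    using arg_cong[OF GH, of transpose_mat] Hc Gc
    by (simp add: transpose_mult[of _ n "N + 1" _ n] transpose_uminus)
  have Mc: "M \<in> carrier_mat n n" unfolding MH using Hc by simp
  \<comment> \<open>Duality makes H injective: M v = 0 gives H v = 0, and then -v = G^T H v =
    0.\<close>
  have "det M \<noteq> 0"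
  proof
    assume "det M = 0"
    then obtain v where v: "v \<in> carrier_vec n" "v \<noteq> 0\<^sub>v n" "M *\<^sub>v v = 0\<^sub>v n"
      using det_0_iff_vec_prod_zero_field[OF Mc] by auto
    have "H *\<^sub>v v = 0\<^sub>v (N + 1)" using v gram_mult_vec_zero[OF Hc] MH by simp
    hence "transpose_mat G * H *\<^sub>v v = transpose_mat G *\<^sub>v 0\<^sub>v (N + 1)"
      using Hc Gc v by (simp add: assoc_mult_mat_vec[of _ n "N + 1" _ n])
    also have "\<dots> = 0\<^sub>v n" using Gc by (intro eq_vecI) auto
    finally have "- v = 0\<^sub>v n" using v(1) unfolding GH by simp
    thus False using v by (metis uminus_uminus_vec uminus_zero_vec)
  qed
  from det_non_zero_imp_unit[OF Mc this, of "()"] obtain B where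
    "B \<in> carrier_mat n n" "M * B = 1\<^sub>m n" "B * M = 1\<^sub>m n"
    by (auto simp: Units_def ring_mat_def)
  note W = mat_inv[OF Mc this]
  define W where "W = mat_inv M"
  note Wc = W(1)[folded W_def] and MW = W(2)[folded W_def] and WM = W(3)[folded W_def]
  have Mt: "transpose_mat M = M" unfolding MH using Hc by (simp add: transpose_mult[of _ n "N + 1" _ n])
  have WtM: "transpose_mat W * M = 1\<^sub>m n"
    using arg_cong[OF MW, of transpose_mat] Mc Wc Mt by (simp add: transpose_mult[of _ n n _ n])
  have "transpose_mat W = transpose_mat W * (M * W)" using Wc MW by simp
  also have "\<dots> = (transpose_mat W * M) * W" using Wc Mc by (intro assoc_mult_mat[symmetric]) auto
  also have "\<dots> = W" unfolding WtM using Wc by simp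
  finally have Wt: "transpose_mat W = W" .
  \<comment> \<open>Since H^T G = -I, the orthogonal projection of G onto the range of H is H W H^T
    G = -H W; subtracting it leaves the part orthogonal to the columns of H.\<close>
  define R where "R = G + H * W"
  have HW: "H * W \<in> carrier_mat (N + 1) n" using Hc Wc by simp
  have Rc: "R \<in> carrier_mat (N + 1) n" unfolding R_def using Gc HW by simp
  have Rt: "transpose_mat R = transpose_mat G + W * transpose_mat H"
    unfolding R_def using Gc HW Hc Wc Wt
    by (simp add: transpose_add[of _ "N + 1" n] transpose_mult[of _ "N + 1" n _ n])
  have RtG: "transpose_mat R * G = stiffS N - W"
  proof -
    have "transpose_mat R * G = transpose_mat G * G + W * (transpose_mat H * G)"
      unfolding Rt using Gc Hc Wc
      by (simp add: add_mult_distrib_mat[of _ n "N + 1" _ _ n] assoc_mult_mat[of _ n n _ "N + 1" _ n])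
    also have "\<dots> = stiffS N - W" unfolding HG SG using Wc Gc
      by (intro eq_matI) auto
    finally show ?thesis .
  qed
  have RtH: "transpose_mat R * H = 0\<^sub>m n n"
  proof -
    have "transpose_mat R * H = transpose_mat G * H + W * (transpose_mat H * H)"
      unfolding Rt using Gc Hc Wc
      by (simp add: add_mult_distrib_mat[of _ n "N + 1" _ _ n] assoc_mult_mat[of _ n n _ "N + 1" _ n])
    also have "\<dots> = 0\<^sub>m n n" unfolding GH MH[symmetric] WM by (intro eq_matI) auto
    finally show ?thesis .
  qed
  \<comment> \<open>Expanding only the right factor gives R^T G + (R^T H) W, whose second term
    vanishes by orthogonality.\<close>
  have RR: "transpose_mat R * R = stiffS N - W"
  proof -
    have "transpose_mat R * R = transpose_mat R * G + (transpose_mat R * H) * W"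
      using Gc Hc Wc Rc HW
      by (subst (2) R_def) (simp add: mult_add_distrib_mat[of _ n "N + 1" _ n] assoc_mult_mat[of _ n "N + 1" _ n _ n])
    thus ?thesis unfolding RtG RtH using Wc SG Gc by (auto simp: stiffS_def n_def)
  qed
  have Sc: "stiffS N \<in> carrier_mat n n" unfolding SG using Gc by simp
  have SW: "stiffS N = W + transpose_mat R * R" unfolding RR using Wc Sc by (intro eq_matI) auto
  have RM: "R * M = G * M + H"
  proof -
    have "R * M = G * M + H * W * M" unfolding R_def using Gc HW Mc by (intro add_mult_distrib_mat) auto
    also have "H * W * M = H" using Hc Wc Mc WM by (simp add: assoc_mult_mat[of _ "N + 1" n _ n _ n])
    finally show ?thesis .
  qed
  have RMc: "R * M \<in> carrier_mat (N + 1) n" using Rc Mc by simp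
  \<comment> \<open>As W M = I, column j holds the coordinates of psi_{j+1} plus the sum over m of
    (psi_{j+1}, psi_{m+1}) phi_{m+1}'.\<close>
  have RM_index: "(R * M) $$ (k, j) = (\<Sum>m<n. l2ip (pderiv (phi (m + 1))) (phi k) * l2ip (psi (j + 1)) (psi (m + 1))) + l2ip (psi (j + 1)) (phi k)"
    if "k < N + 1" "j < n" for k j
    unfolding RM using that Gc Mc Hc
    by (simp add: scalar_prod_def lessThan_atLeast0) (simp add: G_def H_def M_def massM_def phi_coords_def n_def)
  \<comment> \<open>For j < N - 3 the bound (j + 1) + 2 \<le> n holds, and
    \<open>psi_eq_sum_pderiv_phi\<close> says that this polynomial is zero.\<close>
  have RM_low: "(R * M) $$ (k, j) = 0" if "k < N + 1" "j < N - 3" for k j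
  proof -
    have "l2ip (psi (j + 1)) (phi k) = - (\<Sum>m<n. l2ip (pderiv (phi (m + 1))) (phi k) * l2ip (psi (j + 1)) (psi (m + 1)))"
      by (subst psi_eq_sum_pderiv_phi[of "j + 1" n])
        (use that in \<open>auto simp: n_def l2ip_sum_left l2ip_smult_left l2ip_diff_left[of 0, simplified] mult.commute\<close>)
    thus ?thesis using RM_index[of k j] that by (simp add: n_def)
  qed
  \<comment> \<open>The derivatives phi_{m+1}' have degree m < n, so rows n and n + 1 see only
    psi_{j+1}.\<close>
  have RM_top: "(R * M) $$ (k, j) = l2ip (psi (j + 1)) (phi k)" if "k < N + 1" "k \<ge> n" "j < n" for k j
  proof -
    have "l2ip (pderiv (phi (m + 1))) (phi k) = 0" if "m < n" for m
      using that \<open>k \<ge> n\<close> by (subst l2ip_commute) (auto intro!: l2ip_phi_lower simp: degree_pderiv degree_phi)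
    thus ?thesis using RM_index that by simp
  qed
  have RM_top0: "(R * M) $$ (k, j) = 0" if "k < N + 1" "k \<ge> n" "j + 2 < k" "j < n" for k j
    unfolding RM_top[OF that(1,2,4)] using degree_psi_le[of "j + 1"] that
    by (subst l2ip_commute) (auto intro!: l2ip_phi_lower)
  have n3: "n \<ge> 3" and Nn: "N = n + 1" using N by (auto simp: n_def)
  have iff: "(transpose_mat R * R * M) *\<^sub>v y = 0\<^sub>v n \<longleftrightarrow> (\<forall>a<n. a \<in> {N-3..} \<longrightarrow> y $ a = 0)"
    if y: "y \<in> carrier_vec n" for y
  proof -
    have My: "M *\<^sub>v y \<in> carrier_vec n" using Mc y by simp
    have "(transpose_mat R * R * M) *\<^sub>v y = transpose_mat R * R *\<^sub>v (M *\<^sub>v y)"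
      using Rc Mc y by (intro assoc_mult_mat_vec) auto
    hence "(transpose_mat R * R * M) *\<^sub>v y = 0\<^sub>v n \<longleftrightarrow> R *\<^sub>v (M *\<^sub>v y) = 0\<^sub>v (N + 1)"
      using gram_mult_vec_zero[OF Rc My] by simp
    also have "R *\<^sub>v (M *\<^sub>v y) = (R * M) *\<^sub>v y" using Rc Mc y by (intro assoc_mult_mat_vec[symmetric]) auto
    also have "(R * M) *\<^sub>v y = 0\<^sub>v (N + 1) \<longleftrightarrow> (\<forall>k<N+1. (\<Sum>j<n. (R * M) $$ (k, j) * y $ j) = 0)"
      by (rule mult_mat_vec_eq_zero_iff[OF RMc y])
    also have "\<dots> \<longleftrightarrow> (\<forall>a<n. a \<in> {N-3..} \<longrightarrow> y $ a = 0)"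
    proof
      assume y0: "\<forall>a<n. a \<in> {N-3..} \<longrightarrow> y $ a = 0"
      show "\<forall>k<N+1. (\<Sum>j<n. (R * M) $$ (k, j) * y $ j) = 0"
      proof (intro allI impI sum.neutral ballI)
        fix k j assume "k < N + 1" "j \<in> {..<n}"
        thus "(R * M) $$ (k, j) * y $ j = 0" using RM_low[of k j] y0 by (cases "j < N - 3") auto
      qed
    next
      assume *: "\<forall>k<N+1. (\<Sum>j<n. (R * M) $$ (k, j) * y $ j) = 0"
      \<comment> \<open>Among psi_1, ..., psi_n only psi_n reaches degree n + 1, so the last row
        isolates the last entry of y.\<close>
      have "(\<Sum>j<n. (R * M) $$ (n + 1, j) * y $ j) = (\<Sum>j\<in>{n-1}. (R * M) $$ (n + 1, j) * y $ j)"
        using n3 Nn by (intro sum.mono_neutral_right) (auto simp: RM_top0)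
      hence "(R * M) $$ (n + 1, n - 1) * y $ (n - 1) = 0" using * Nn by simp
      moreover have "(R * M) $$ (n + 1, n - 1) \<noteq> 0"
        using RM_top[of "n + 1" "n - 1"] l2ip_psi_phi_top[of n] n3 Nn by simp
      ultimately have y1: "y $ (n - 1) = 0" by simp
      \<comment> \<open>Row n can involve only psi_{n-1} and psi_n; the contribution of psi_n is
        removed by \<open>y1\<close>.\<close>
      have "(\<Sum>j<n. (R * M) $$ (n, j) * y $ j) = (\<Sum>j\<in>{n-2}. (R * M) $$ (n, j) * y $ j)"
      proof (intro sum.mono_neutral_right ballI)
        fix j assume "j \<in> {..<n} - {n - 2}"
        hence "j = n - 1 \<or> (j < n \<and> j + 2 < n)" by auto
        thus "(R * M) $$ (n, j) * y $ j = 0" using y1 Nn RM_top0[of n j] by auto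
      qed (use n3 in auto)
      hence "(R * M) $$ (n, n - 2) * y $ (n - 2) = 0" using * Nn by simp
      moreover have "(R * M) $$ (n, n - 2) \<noteq> 0"
        using RM_top[of n "n - 2"] l2ip_psi_phi_top[of "n - 1"] n3 Nn by (simp add: numeral_2_eq_2 Suc_diff_Suc)
      ultimately have y2: "y $ (n - 2) = 0" by simp
      show "\<forall>a<n. a \<in> {N-3..} \<longrightarrow> y $ a = 0"
      proof (intro allI impI)
        fix a assume "a < n" "a \<in> {N-3..}"
        hence "a = n - 1 \<or> a = n - 2" using Nn by auto
        thus "y $ a = 0" using y1 y2 by auto
      qed
    qed
    finally show ?thesis .
  qed
  show ?thesis
    by (rule that[of H R]) (use Hc Rc MH Wc MW WM SW iff in \<open>simp_all add: n_def M_def W_def\<close>)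
qed

section \<open>The kernel of the block matrix\<close>

lemma kron_add:
  fixes A :: "'a :: comm_ring_1 mat"
  assumes A: "A \<in> carrier_mat a a'" and A': "A' \<in> carrier_mat a a'" and B: "B \<in> carrier_mat b b'"
  shows "kron (A + A') B = kron A B + kron A' B" "kron B (A + A') = kron B A + kron B A'"
proof -
  have AA: "A + A' \<in> carrier_mat a a'" using A A' by simp
  show "kron (A + A') B = kron A B + kron A' B"
    using kron_carrier[OF A B] kron_carrier[OF A' B] kron_carrier[OF AA B] A A'
    by (intro eq_matI)
      (auto simp: kron_index[OF A B] kron_index[OF A' B] kron_index[OF AA B] div_mod_less distrib_right)
  show "kron B (A + A') = kron B A + kron B A'"
    using kron_carrier[OF B A] kron_carrier[OF B A'] kron_carrier[OF B AA] A A'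
    by (intro eq_matI)
      (auto simp: kron_index[OF B A] kron_index[OF B A'] kron_index[OF B AA] div_mod_less distrib_left)
qed

lemma kron3_add:
  fixes A :: "'a :: comm_ring_1 mat"
  assumes A: "A \<in> carrier_mat a a'" and A': "A' \<in> carrier_mat a a'"
    and B: "B \<in> carrier_mat b b'" and C: "C \<in> carrier_mat c c'"
  shows "kron3 (A + A') B C = kron3 A B C + kron3 A' B C"
    "kron3 B (A + A') C = kron3 B A C + kron3 B A' C"
    "kron3 B C (A + A') = kron3 B C A + kron3 B C A'"
  unfolding kron3_def kron_add(1)[OF A A' B] kron_add(2)[OF A A' B] kron_add(2)[OF A A' kron_carrier[OF B C]]
  by (rule kron_add(1)[OF kron_carrier[OF A B] kron_carrier[OF A' B] C]
      kron_add(1)[OF kron_carrier[OF B A] kron_carrier[OF B A'] C] refl)+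

text \<open>\<open>char_matrix A e\<close> is A - e I, whose kernel is the eigenspace of A for
  e.\<close>

lemma char_matrix_one_add:
  fixes X :: "'a :: field mat"
  assumes "X \<in> carrier_mat n n"
  shows "char_matrix (1\<^sub>m n + X) 1 = X"
  unfolding char_matrix_def using assms by (intro eq_matI) auto

text \<open>The linear part in S of \<open>blk11\<close>, evaluated at D; together with its
  companions it describes A - At when D = S - M^{-1}.\<close>

definition defect11 :: "nat \<Rightarrow> real mat \<Rightarrow> real mat \<Rightarrow> real mat" where
  "defect11 n D M = kron3 D M (1\<^sub>m n) + kron3 D (1\<^sub>m n) M + kron3 (1\<^sub>m n) M D + kron3 (1\<^sub>m n) D M"

definition defect22 :: "nat \<Rightarrow> real mat \<Rightarrow> real mat \<Rightarrow> real mat" where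
  "defect22 n D M = kron3 M D (1\<^sub>m n) + kron3 D (1\<^sub>m n) M + kron3 M (1\<^sub>m n) D + kron3 (1\<^sub>m n) D M"

definition defect12 :: "nat \<Rightarrow> real mat \<Rightarrow> real mat \<Rightarrow> real mat" where
  "defect12 n D M = kron3 D (1\<^sub>m n) M + kron3 (1\<^sub>m n) D M"

definition defect :: "nat \<Rightarrow> real mat \<Rightarrow> real mat \<Rightarrow> real mat" where
  "defect n D M = four_block_mat (defect11 n D M) (defect12 n D M) (defect12 n D M) (defect22 n D M)"

lemma defect_carrier [simp]:
  assumes "D \<in> carrier_mat n n" "M \<in> carrier_mat n n"
  shows "defect11 n D M \<in> carrier_mat (n * n * n) (n * n * n)"
    "defect12 n D M \<in> carrier_mat (n * n * n) (n * n * n)"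
    "defect22 n D M \<in> carrier_mat (n * n * n) (n * n * n)"
    "defect n D M \<in> carrier_mat (n * n * n + n * n * n) (n * n * n + n * n * n)"
  using assms by (simp_all add: defect_def defect11_def defect12_def defect22_def)

lemma blockmat_carrier:
  assumes "S \<in> carrier_mat (N - 1) (N - 1)" "M \<in> carrier_mat (N - 1) (N - 1)" and n: "n = (N - 1) * (N - 1) * (N - 1)"
  shows "blk11 N \<kappa> S M \<in> carrier_mat n n" "blk12 N \<kappa> S M \<in> carrier_mat n n" "blk22 N \<kappa> S M \<in> carrier_mat n n"
    "blockmat N \<kappa> S M \<in> carrier_mat (n + n) (n + n)"
  using assms by (simp_all add: blockmat_def blk11_def blk12_def blk22_def Let_def)

text \<open>Each block is affine in S, so replacing W by W + D adds just the linear part at D; the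
  identity and \<kappa> terms are the same on both sides.\<close>

lemma blockmat_add:
  fixes N defines "n \<equiv> N - 1"
  assumes W: "W \<in> carrier_mat n n" and D: "D \<in> carrier_mat n n" and M: "M \<in> carrier_mat n n"
  shows "blockmat N \<kappa> (W + D) M = blockmat N \<kappa> W M + defect n D M"
proof -
  have I: "1\<^sub>m n \<in> carrier_mat n n" by simp
  note add = kron3_add(1)[OF W D I M] kron3_add(1)[OF W D M I] kron3_add(2)[OF W D I M] kron3_add(2)[OF W D M I]
    kron3_add(3)[OF W D I M] kron3_add(3)[OF W D M I]
  have c: "kron3 A B C \<in> carrier_mat (n*n*n) (n*n*n)"
    if "A \<in> carrier_mat n n" "B \<in> carrier_mat n n" "C \<in> carrier_mat n n" for A B C :: "real mat"
    using that by simp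
  have d: "dim_row (kron3 A B C) = n*n*n" "dim_col (kron3 A B C) = n*n*n"
    if "A \<in> carrier_mat n n" "B \<in> carrier_mat n n" "C \<in> carrier_mat n n" for A B C :: "real mat"
    using c[OF that] by auto
  have 11: "blk11 N \<kappa> (W + D) M = blk11 N \<kappa> W M + defect11 n D M"
    unfolding blk11_def defect11_def Let_def n_def[symmetric] add
    by (rule eq_matI) (auto simp: d W D M)
  have 12: "blk12 N \<kappa> (W + D) M = blk12 N \<kappa> W M + defect12 n D M"
    unfolding blk12_def defect12_def Let_def n_def[symmetric] add
    by (rule eq_matI) (auto simp: d W D M)
  have 22: "blk22 N \<kappa> (W + D) M = blk22 N \<kappa> W M + defect22 n D M"
    unfolding blk22_def defect22_def Let_def n_def[symmetric] add
    by (rule eq_matI) (auto simp: d W D M)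
  note bc = blockmat_carrier[OF W[unfolded n_def] M[unfolded n_def] refl, of \<kappa>, folded n_def]
  show ?thesis
    unfolding blockmat_def defect_def 11 12 22
    by (rule add_four_block_mat[symmetric, OF bc(1) bc(2) bc(2) bc(3)]) (use D M in simp_all)
qed

text \<open>The vanishing squares put \<open>u\<close> in the kernel of D in slots 1 and 3,
  \<open>w\<close> in slots 2 and 3, and \<open>u + w\<close> in slots 1 and 2. Subtraction supplies
  \<open>w\<close> in slot 1 and \<open>u\<close> in slot 2. Conversely, every Kronecker term of the
  defect contains D in some slot.\<close>

lemma defect_kernel_iff:
  assumes D: "D = transpose_mat R * R" and R: "R \<in> carrier_mat r n"
    and M: "M = transpose_mat H * H" and H: "H \<in> carrier_mat h n"
    and W: "W \<in> carrier_mat n n" and WM: "W * M = 1\<^sub>m n"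
    and u: "u \<in> carrier_vec (n * n * n)" and w: "w \<in> carrier_vec (n * n * n)"
  shows "defect n D M *\<^sub>v (u @\<^sub>v w) = 0\<^sub>v (n * n * n + n * n * n) \<longleftrightarrow>
    (\<forall>K \<in> {kron3 D (1\<^sub>m n) (1\<^sub>m n), kron3 (1\<^sub>m n) D (1\<^sub>m n), kron3 (1\<^sub>m n) (1\<^sub>m n) D}.
       u \<in> mat_kernel K \<and> w \<in> mat_kernel K)"
    (is "_ = ?rhs")
proof -
  let ?n = "n * n * n"
  let ?I = "1\<^sub>m n :: real mat"
  have Dc: "D \<in> carrier_mat n n" and Mc: "M \<in> carrier_mat n n" using D M R H by auto
  have I: "?I \<in> carrier_mat n n" and II: "?I * ?I = ?I" and It: "transpose_mat ?I * ?I = ?I" by auto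
  \<comment> \<open>Two instances are needed because the companion M may occupy either of the two
    slots not taken by D.\<close>
  note slots = mat_kernel_kron3_slots[OF Dc Mc W WM I I II] mat_kernel_kron3_slots[OF Dc I I II Mc W WM]
  have kc: "kron3 A B C \<in> carrier_mat ?n ?n"
    if "A \<in> carrier_mat n n" "B \<in> carrier_mat n n" "C \<in> carrier_mat n n" for A B C :: "real mat"
    using that by simp
  note kcs = kc[OF Dc Mc I] kc[OF Dc I Mc] kc[OF I Mc Dc] kc[OF I Dc Mc] kc[OF Mc Dc I] kc[OF Mc I Dc]
  have ker: "K *\<^sub>v x = 0\<^sub>v ?n \<longleftrightarrow> x \<in> mat_kernel K" if "K \<in> carrier_mat ?n ?n" "x \<in> carrier_vec ?n" for K :: "real mat" and x
    using that by (auto simp: mat_kernel)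
  have "defect n D M *\<^sub>v (u @\<^sub>v w) = (defect11 n D M *\<^sub>v u + defect12 n D M *\<^sub>v w) @\<^sub>v (defect12 n D M *\<^sub>v u + defect22 n D M *\<^sub>v w)"
    unfolding defect_def using u w defect_carrier(1-3)[OF Dc Mc]
    by (intro four_block_mat_mult_vec[of _ ?n ?n _ ?n _ ?n])
  moreover have "(0\<^sub>v (?n + ?n) :: real vec) = 0\<^sub>v ?n @\<^sub>v 0\<^sub>v ?n" by auto
  moreover have "defect11 n D M *\<^sub>v u + defect12 n D M *\<^sub>v w \<in> carrier_vec ?n"
    by (intro add_carrier_vec mult_mat_vec_carrier[OF defect_carrier(1) u] mult_mat_vec_carrier[OF defect_carrier(2) w] Dc Mc)
  ultimately have split: "defect n D M *\<^sub>v (u @\<^sub>v w) = 0\<^sub>v (?n + ?n) \<longleftrightarrow>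
      defect11 n D M *\<^sub>v u + defect12 n D M *\<^sub>v w = 0\<^sub>v ?n \<and> defect12 n D M *\<^sub>v u + defect22 n D M *\<^sub>v w = 0\<^sub>v ?n"
    by (simp add: append_vec_eq[where n = ?n])
  show ?thesis unfolding split
  proof
    assume e: "defect11 n D M *\<^sub>v u + defect12 n D M *\<^sub>v w = 0\<^sub>v ?n \<and> defect12 n D M *\<^sub>v u + defect22 n D M *\<^sub>v w = 0\<^sub>v ?n"
    have psds: "psd ?n (kron3 D M ?I)" "psd ?n (kron3 D ?I M)" "psd ?n (kron3 ?I M D)" "psd ?n (kron3 ?I D M)"
      "psd ?n (kron3 M D ?I)" "psd ?n (kron3 M ?I D)"
      using psd_kron3_gram[OF R H I] psd_kron3_gram[OF R I H] psd_kron3_gram[OF I H R] psd_kron3_gram[OF I R H]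
        psd_kron3_gram[OF H R I] psd_kron3_gram[OF H I R]
      unfolding D[symmetric] M[symmetric] It by auto
    note k = psd_block_kernel[OF psds u w e[THEN conjunct1, unfolded defect11_def defect12_def]
        e[THEN conjunct2, unfolded defect22_def defect12_def]]
    have uw: "u + w \<in> carrier_vec ?n" using u w by simp
    note k' = k[unfolded ker[OF kcs(1) u] ker[OF kcs(3) u] ker[OF kcs(5) w] ker[OF kcs(6) w] ker[OF kcs(2) uw] ker[OF kcs(4) uw] slots]
    \<comment> \<open>Membership of the sum lets membership pass from one summand to the other; this
      is used in slots 1 and 2.\<close>
    have cancel: "x \<in> mat_kernel K \<longleftrightarrow> y \<in> mat_kernel K"
      if "K \<in> carrier_mat ?n ?n" "x + y \<in> mat_kernel K" "x \<in> carrier_vec ?n" "y \<in> carrier_vec ?n"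
      for K :: "real mat" and x y
    proof -
      have "K *\<^sub>v x + K *\<^sub>v y = 0\<^sub>v ?n"
        using that mult_add_distrib_mat_vec[OF that(1,3,4)] by (auto simp: mat_kernel[OF that(1)])
      moreover have "K *\<^sub>v x \<in> carrier_vec ?n" "K *\<^sub>v y \<in> carrier_vec ?n"
        using mult_mat_vec_carrier[OF that(1,3)] mult_mat_vec_carrier[OF that(1,4)] by auto
      ultimately have "K *\<^sub>v x = 0\<^sub>v ?n \<longleftrightarrow> K *\<^sub>v y = 0\<^sub>v ?n"
        by (metis left_zero_vec right_zero_vec)
      thus ?thesis using that by (simp add: mat_kernel[OF that(1)])
    qed
    show ?rhs
      using k' cancel[OF kc[OF Dc I I] _ u w] cancel[OF kc[OF I Dc I] _ u w] by blast
  next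
    assume ?rhs
    hence r: "x \<in> mat_kernel (kron3 D M ?I)" "x \<in> mat_kernel (kron3 D ?I M)" "x \<in> mat_kernel (kron3 ?I M D)" "x \<in> mat_kernel (kron3 ?I D M)"
      "x \<in> mat_kernel (kron3 M D ?I)" "x \<in> mat_kernel (kron3 M ?I D)" if "x \<in> {u, w}" for x
      using that unfolding slots by auto
    have z: "(A + B) *\<^sub>v x = 0\<^sub>v ?n" if "A \<in> carrier_mat ?n ?n" "B \<in> carrier_mat ?n ?n" "x \<in> carrier_vec ?n"
      "A *\<^sub>v x = 0\<^sub>v ?n" "B *\<^sub>v x = 0\<^sub>v ?n" for A B :: "real mat" and x
      using add_mult_distrib_mat_vec[OF that(1-3)] that(4,5) by simp
    have "defect11 n D M *\<^sub>v x = 0\<^sub>v ?n \<and> defect12 n D M *\<^sub>v x = 0\<^sub>v ?n \<and> defect22 n D M *\<^sub>v x = 0\<^sub>v ?n"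
      if x: "x \<in> {u, w}" for x
    proof -
      have xc: "x \<in> carrier_vec ?n" using x u w by auto
      note r' = r[OF x, folded ker[OF kcs(1) xc] ker[OF kcs(2) xc] ker[OF kcs(3) xc] ker[OF kcs(4) xc] ker[OF kcs(5) xc] ker[OF kcs(6) xc]]
      show ?thesis unfolding defect11_def defect12_def defect22_def
        using xc r' kcs by (intro conjI z add_carrier_mat)
    qed
    thus "defect11 n D M *\<^sub>v u + defect12 n D M *\<^sub>v w = 0\<^sub>v ?n \<and> defect12 n D M *\<^sub>v u + defect22 n D M *\<^sub>v w = 0\<^sub>v ?n"
      by simp
  qed
qed

section \<open>Counting free coordinates and the kernel dimension\<close>

text \<open>An index encodes a tuple (s, a, b, c), where s selects the half of the block vector and
  a, b, c are the tensor indices. Two choices of s and m of each tensor index remain.\<close>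

lemma card_mod_lattice:
  assumes "m \<le> n"
  shows "card {i. i < n * n * n + n * n * n \<and> (i mod (n * n * n)) div n div n < m \<and> (i mod (n * n * n)) div n mod n < m \<and> i mod (n * n * n) mod n < m} = 2 * m ^ 3"
    (is "card ?J = _")
proof -
  let ?n = "n * n * n"
  define f where "f = (\<lambda>(s, a, b, c). s * ?n + ((a * n + b) * n + c))"
  have "bij_betw f ({..<2} \<times> {..<m} \<times> {..<m} \<times> {..<m}) ?J"
  proof (rule bij_betw_byWitness[where f' = "\<lambda>i. (i div ?n, i mod ?n div n div n, i mod ?n div n mod n, i mod ?n mod n)"])
    have f: "f (s, a, b, c) < ?n + ?n" "f (s, a, b, c) div ?n = s" "f (s, a, b, c) mod ?n = (a * n + b) * n + c"
      if "s < 2" "a < m" "b < m" "c < m" for s a b c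
    proof -
      have "(a * n + b) * n + c < ?n" using that assms by (intro mult_add_less) auto
      moreover have "n \<noteq> 0" using that assms by auto
      hence "(s * ?n + ((a * n + b) * n + c)) div ?n = s + ((a * n + b) * n + c) div ?n"
        by (intro div_mult_self3) simp
      moreover have "f (s, a, b, c) < 2 * ?n" unfolding f_def prod.case
        using that(1) calculation(1) by (rule mult_add_less)
      ultimately show "f (s, a, b, c) < ?n + ?n" "f (s, a, b, c) div ?n = s" "f (s, a, b, c) mod ?n = (a * n + b) * n + c"
        by (auto simp: f_def)
    qed
    have g: "((a * n + b) * n + c) div n = a * n + b" "((a * n + b) * n + c) mod n = c" "(a * n + b) div n = a" "(a * n + b) mod n = b"
      if "a < m" "b < m" "c < m" for a b c
      using that assms by auto
    show "\<forall>x\<in>{..<2} \<times> {..<m} \<times> {..<m} \<times> {..<m}. (f x div ?n, f x mod ?n div n div n, f x mod ?n div n mod n, f x mod ?n mod n) = x"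
      by (auto simp only: f g lessThan_iff mem_Times_iff fst_conv snd_conv split: prod.splits)
    show "\<forall>i\<in>?J. f (i div ?n, i mod ?n div n div n, i mod ?n div n mod n, i mod ?n mod n) = i"
      unfolding f_def prod.case div_mult_mod_eq by simp
    show "f ` ({..<2} \<times> {..<m} \<times> {..<m} \<times> {..<m}) \<subseteq> ?J"
      by (auto simp only: f g lessThan_iff mem_Times_iff fst_conv snd_conv mem_Collect_eq split: prod.splits)
    show "(\<lambda>i. (i div ?n, i mod ?n div n div n, i mod ?n div n mod n, i mod ?n mod n)) ` ?J \<subseteq> {..<2} \<times> {..<m} \<times> {..<m} \<times> {..<m}"
      by (auto intro!: less_mult_imp_div_less)
  qed
  from bij_betw_same_card[OF this] show ?thesis by (simp add: card_cartesian_product power3_eq_cube)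
qed

lemma all3_disj:
  "(\<forall>a<n::nat. \<forall>b<n. \<forall>c<n. A a \<or> A b \<or> A c \<longrightarrow> P a b c) \<longleftrightarrow>
   (\<forall>a<n. \<forall>b<n. \<forall>c<n. A a \<longrightarrow> P a b c) \<and> (\<forall>a<n. \<forall>b<n. \<forall>c<n. A b \<longrightarrow> P a b c) \<and>
   (\<forall>a<n. \<forall>b<n. \<forall>c<n. A c \<longrightarrow> P a b c)"
  by auto

text \<open>The invertible substitution v = P v' preserves the kernel dimension and replaces D by D
  M in each slot. By \<open>ker\<close> the new kernel consists of the arrays supported where all
  three tensor indices are below m, in either half.\<close>

lemma kernel_dim_defect:
  assumes D: "D = transpose_mat R * R" and R: "R \<in> carrier_mat r n"
    and M: "M = transpose_mat H * H" and H: "H \<in> carrier_mat h n"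
    and W: "W \<in> carrier_mat n n" and WM: "W * M = 1\<^sub>m n" and MW: "M * W = 1\<^sub>m n" and m: "m \<le> n"
    and ker: "\<And>y. y \<in> carrier_vec n \<Longrightarrow> (D * M) *\<^sub>v y = 0\<^sub>v n \<longleftrightarrow> (\<forall>a<n. a \<in> {m..} \<longrightarrow> y $ a = 0)"
  shows "kernel_dim (defect n D M) = 2 * m ^ 3"
proof -
  let ?n = "n * n * n"
  let ?I = "1\<^sub>m n :: real mat"
  have Dc: "D \<in> carrier_mat n n" and Mc: "M \<in> carrier_mat n n" using D M R H by auto
  have I: "?I \<in> carrier_mat n n" by simp
  have DM: "D * M \<in> carrier_mat n n" using Dc Mc by simp
  define Q where "Q = kron3 M M M"
  define Q' where "Q' = kron3 W W W"
  have Qc: "Q \<in> carrier_mat ?n ?n" and Q'c: "Q' \<in> carrier_mat ?n ?n" using Mc W by (auto simp: Q_def Q'_def)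
  have QQ: "Q * Q' = 1\<^sub>m ?n" "Q' * Q = 1\<^sub>m ?n"
    using Mc W MW WM by (simp_all add: Q_def Q'_def kron3_mult[of _ n n _ n n _ n n _ n _ n _ n] kron3_one)
  let ?Z = "0\<^sub>m ?n ?n :: real mat"
  define P where "P = four_block_mat Q ?Z ?Z Q"
  define P' where "P' = four_block_mat Q' ?Z ?Z Q'"
  have Pc: "P \<in> carrier_mat (?n + ?n) (?n + ?n)" and P'c: "P' \<in> carrier_mat (?n + ?n) (?n + ?n)"
    using Qc Q'c by (auto simp: P_def P'_def)
  have PP: "P * P' = 1\<^sub>m (?n + ?n)"
    unfolding P_def P'_def using Qc Q'c
    by (subst mult_four_block_mat[of _ ?n ?n _ ?n _ ?n _ _ ?n _ ?n]) (auto simp: QQ)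
  let ?J = "{i. i < ?n + ?n \<and> (i mod ?n) div n div n < m \<and> (i mod ?n) div n mod n < m \<and> i mod ?n mod n < m}"
  have Ec: "defect n D M \<in> carrier_mat (?n + ?n) (?n + ?n)" using Dc Mc by simp
  have slots: "(\<forall>K \<in> {kron3 D ?I ?I, kron3 ?I D ?I, kron3 ?I ?I D}. Q *\<^sub>v z \<in> mat_kernel K) \<longleftrightarrow>
      (\<forall>i<?n. \<not> (i div n div n < m \<and> i div n mod n < m \<and> i mod n < m) \<longrightarrow> z $ i = 0)"
    if z: "z \<in> carrier_vec ?n" for z
  proof -
    have k: "Q *\<^sub>v z \<in> mat_kernel K \<longleftrightarrow> z \<in> mat_kernel (K * Q)" if "K \<in> carrier_mat ?n ?n" for K
      using that Qc z by (auto simp: mat_kernel[of _ ?n ?n])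
    have kc: "kron3 D ?I ?I \<in> carrier_mat ?n ?n" "kron3 ?I D ?I \<in> carrier_mat ?n ?n" "kron3 ?I ?I D \<in> carrier_mat ?n ?n"
      "kron3 (D * M) ?I ?I \<in> carrier_mat ?n ?n" "kron3 ?I (D * M) ?I \<in> carrier_mat ?n ?n" "kron3 ?I ?I (D * M) \<in> carrier_mat ?n ?n"
      using Dc Mc by auto
    \<comment> \<open>The active slot becomes D M; the other two carry the invertible M, which
      \<open>mat_kernel_kron3_slots\<close> strips off.\<close>
    have KQ: "kron3 D ?I ?I * Q = kron3 (D * M) M M" "kron3 ?I D ?I * Q = kron3 M (D * M) M" "kron3 ?I ?I D * Q = kron3 M M (D * M)"
      using Dc Mc by (simp_all add: Q_def kron3_mult[of _ n n _ n n _ n n _ n _ n _ n])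
    have "(\<forall>K \<in> {kron3 D ?I ?I, kron3 ?I D ?I, kron3 ?I ?I D}. Q *\<^sub>v z \<in> mat_kernel K) \<longleftrightarrow>
      z \<in> mat_kernel (kron3 (D * M) ?I ?I) \<and> z \<in> mat_kernel (kron3 ?I (D * M) ?I) \<and> z \<in> mat_kernel (kron3 ?I ?I (D * M))"
      using k[OF kc(1)] k[OF kc(2)] k[OF kc(3)] unfolding KQ mat_kernel_kron3_slots[OF DM Mc W WM Mc W WM] by simp
    moreover have slot: "kron3 (D * M) ?I ?I *\<^sub>v z = 0\<^sub>v ?n \<longleftrightarrow> (\<forall>a<n. \<forall>b<n. \<forall>c<n. a \<in> {m..} \<longrightarrow> z $ ((a * n + b) * n + c) = 0)"
      "kron3 ?I (D * M) ?I *\<^sub>v z = 0\<^sub>v ?n \<longleftrightarrow> (\<forall>a<n. \<forall>b<n. \<forall>c<n. b \<in> {m..} \<longrightarrow> z $ ((a * n + b) * n + c) = 0)"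
      "kron3 ?I ?I (D * M) *\<^sub>v z = 0\<^sub>v ?n \<longleftrightarrow> (\<forall>a<n. \<forall>b<n. \<forall>c<n. c \<in> {m..} \<longrightarrow> z $ ((a * n + b) * n + c) = 0)"
      by (rule kron3_slot_zero_iff[OF DM z], erule ker)+
    ultimately have "(\<forall>K \<in> {kron3 D ?I ?I, kron3 ?I D ?I, kron3 ?I ?I D}. Q *\<^sub>v z \<in> mat_kernel K) \<longleftrightarrow> (\<forall>a<n. \<forall>b<n. \<forall>c<n. (a \<in> {m..} \<or> b \<in> {m..} \<or> c \<in> {m..}) \<longrightarrow> z $ ((a * n + b) * n + c) = 0)"
      unfolding mat_kernel[OF kc(4)] mat_kernel[OF kc(5)] mat_kernel[OF kc(6)] mem_Collect_eq slot
      using all3_disj[of n "\<lambda>a. a \<in> {m..}" "\<lambda>a b c. z $ ((a * n + b) * n + c) = 0"] by (simp only: z simp_thms)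
    also have "\<dots> \<longleftrightarrow> (\<forall>i<?n. \<not> (i div n div n < m \<and> i div n mod n < m \<and> i mod n < m) \<longrightarrow> z $ i = 0)"
    proof
      assume *: "\<forall>a<n. \<forall>b<n. \<forall>c<n. (a \<in> {m..} \<or> b \<in> {m..} \<or> c \<in> {m..}) \<longrightarrow> z $ ((a * n + b) * n + c) = 0"
      show "\<forall>i<?n. \<not> (i div n div n < m \<and> i div n mod n < m \<and> i mod n < m) \<longrightarrow> z $ i = 0"
      proof (intro allI impI)
        fix i assume i: "i < ?n" and ni: "\<not> (i div n div n < m \<and> i div n mod n < m \<and> i mod n < m)"
        have "z $ ((i div n div n * n + i div n mod n) * n + i mod n) = 0"
          by (rule *[rule_format, OF div_mod_less[OF div_mod_less(1)[OF i]] div_mod_less(2)[OF i]])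
            (use ni in \<open>auto simp: not_less\<close>)
        thus "z $ i = 0" by simp
      qed
    next
      assume *: "\<forall>i<?n. \<not> (i div n div n < m \<and> i div n mod n < m \<and> i mod n < m) \<longrightarrow> z $ i = 0"
      show "\<forall>a<n. \<forall>b<n. \<forall>c<n. (a \<in> {m..} \<or> b \<in> {m..} \<or> c \<in> {m..}) \<longrightarrow> z $ ((a * n + b) * n + c) = 0"
      proof (intro allI impI)
        fix a b c assume abc: "a < n" "b < n" "c < n" "a \<in> {m..} \<or> b \<in> {m..} \<or> c \<in> {m..}"
        have "(a * n + b) * n + c < ?n" using abc by (intro mult_add_less)
        thus "z $ ((a * n + b) * n + c) = 0" using * abc by auto
      qed
    qed
    finally show ?thesis .
  qed
  have "kernel_dim (defect n D M * P) = card ?J"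
  proof (rule kernel_dim_coordinate_subspace)
    show EP: "defect n D M * P \<in> carrier_mat (?n + ?n) (?n + ?n)" using Ec Pc by simp
    show "?J \<subseteq> {..<?n + ?n}" by auto
    have "(defect n D M * P) *\<^sub>v v = 0\<^sub>v (?n + ?n) \<longleftrightarrow> (\<forall>i<?n + ?n. i \<notin> ?J \<longrightarrow> v $ i = 0)"
      if v: "v \<in> carrier_vec (?n + ?n)" for v
    proof -
      define z1 where "z1 = vec_first v ?n"
      define z2 where "z2 = vec_last v ?n"
      have z: "z1 \<in> carrier_vec ?n" "z2 \<in> carrier_vec ?n" and vz: "v = z1 @\<^sub>v z2"
        using v by (auto simp: z1_def z2_def)
      have Pv: "P *\<^sub>v v = (Q *\<^sub>v z1) @\<^sub>v (Q *\<^sub>v z2)"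
      proof -
        have "P *\<^sub>v v = (Q *\<^sub>v z1 + ?Z *\<^sub>v z2) @\<^sub>v (?Z *\<^sub>v z1 + Q *\<^sub>v z2)"
          unfolding P_def vz using Qc z by (intro four_block_mat_mult_vec) auto
        moreover have "?Z *\<^sub>v z2 = 0\<^sub>v ?n" "?Z *\<^sub>v z1 = 0\<^sub>v ?n" using z by (auto intro!: eq_vecI)
        ultimately show ?thesis
          using mult_mat_vec_carrier[OF Qc z(1)] mult_mat_vec_carrier[OF Qc z(2)] by simp
      qed
      have "(defect n D M * P) *\<^sub>v v = defect n D M *\<^sub>v (P *\<^sub>v v)"
        by (rule assoc_mult_mat_vec[OF Ec Pc v])
      also have "\<dots> = 0\<^sub>v (?n + ?n) \<longleftrightarrow>
          (\<forall>K \<in> {kron3 D ?I ?I, kron3 ?I D ?I, kron3 ?I ?I D}. Q *\<^sub>v z1 \<in> mat_kernel K \<and> Q *\<^sub>v z2 \<in> mat_kernel K)"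
        unfolding Pv by (rule defect_kernel_iff[OF D R M H W WM mult_mat_vec_carrier[OF Qc z(1)] mult_mat_vec_carrier[OF Qc z(2)]])
      also have "\<dots> \<longleftrightarrow> (\<forall>i<?n. \<not> (i div n div n < m \<and> i div n mod n < m \<and> i mod n < m) \<longrightarrow> z1 $ i = 0 \<and> z2 $ i = 0)"
        using slots[OF z(1)] slots[OF z(2)] by blast
      also have "\<dots> \<longleftrightarrow> (\<forall>i<?n + ?n. i \<notin> ?J \<longrightarrow> v $ i = 0)"
      proof -
        have v1: "v $ i = z1 $ i" "v $ (?n + i) = z2 $ i" if "i < ?n" for i
          unfolding vz using that z by auto
        \<comment> \<open>The block vector is treated one half at a time: position ?n + i carries
          the same tensor index as position i.\<close>
        have split: "(\<forall>i<?n + ?n. p i) \<longleftrightarrow> (\<forall>i<?n. p i \<and> p (?n + i))" for p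
        proof
          assume *: "\<forall>i<?n. p i \<and> p (?n + i)"
          show "\<forall>i<?n + ?n. p i"
          proof (intro allI impI)
            fix i assume i: "i < ?n + ?n"
            show "p i"
            proof (cases "i < ?n")
              case False
              hence "i - ?n < ?n" "?n + (i - ?n) = i" using i by auto
              thus ?thesis using * by metis
            qed (use * in auto)
          qed
        qed auto
        show ?thesis unfolding split by (intro all_cong) (simp add: v1, blast)
      qed
      finally show ?thesis .
    qed
    thus "mat_kernel (defect n D M * P) = {v \<in> carrier_vec (?n + ?n). \<forall>i<?n + ?n. i \<notin> ?J \<longrightarrow> v $ i = 0}"
      unfolding mat_kernel[OF EP] by blast
  qed
  \<comment> \<open>Right multiplication by P changes the kernel itself but, P being invertible, not
    its dimension.\<close>
  moreover have "kernel_dim (defect n D M * P) = kernel_dim (defect n D M)"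
    using mat_kernel_dim_mult_eq_right[OF Ec Pc P'c PP] carrier_matD(2)[OF Pc] carrier_matD(2)[OF Ec]
    by (simp add: kernel_dim_def)
  ultimately show ?thesis using card_mod_lattice[OF m] by simp
qed

section \<open>From the eigenspace to the kernel of the difference A - At\<close>

theorem mainTheorem11:
  fixes N :: nat and \<kappa> :: real
  assumes "N \<ge> 4"
    and "invertible_mat (matAt N \<kappa>)"
  shows "kernel_dim (char_matrix (mat_inv (matAt N \<kappa>) * matA N \<kappa>) 1) = 2 * (N - 3) ^ 3"
proof -
  obtain H R where H: "H \<in> carrier_mat (N + 1) (N - 1)" and R: "R \<in> carrier_mat (N + 1) (N - 1)"
    and M: "massM N = transpose_mat H * H"
    and W: "mat_inv (massM N) \<in> carrier_mat (N - 1) (N - 1)"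
    and MW: "massM N * mat_inv (massM N) = 1\<^sub>m (N - 1)" and WM: "mat_inv (massM N) * massM N = 1\<^sub>m (N - 1)"
    and S: "stiffS N = mat_inv (massM N) + transpose_mat R * R"
    and ker: "\<And>y. y \<in> carrier_vec (N - 1) \<Longrightarrow>
      (transpose_mat R * R * massM N) *\<^sub>v y = 0\<^sub>v (N - 1) \<longleftrightarrow> (\<forall>a<N-1. a \<in> {N-3..} \<longrightarrow> y $ a = 0)"
    by (rule mass_stiffness_defect[OF assms(1)]) (rule that)
  define n where "n = (N - 1) * (N - 1) * (N - 1)"
  define E where "E = defect (N - 1) (transpose_mat R * R) (massM N)"
  have Mc: "massM N \<in> carrier_mat (N - 1) (N - 1)" and Dc: "transpose_mat R * R \<in> carrier_mat (N - 1) (N - 1)"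
    using H R by (auto simp: M)
  have Ac: "matAt N \<kappa> \<in> carrier_mat (n + n) (n + n)"
    unfolding matAt_def by (rule blockmat_carrier(4)[OF W Mc n_def])
  have Ec: "E \<in> carrier_mat (n + n) (n + n)"
    unfolding E_def n_def by (rule defect_carrier(4)[OF Dc Mc])
  have A: "matA N \<kappa> = matAt N \<kappa> + E"
    unfolding matA_def matAt_def E_def S by (rule blockmat_add[OF W Dc Mc])
  obtain B where B: "matAt N \<kappa> * B = 1\<^sub>m (n + n)" "B * matAt N \<kappa> = 1\<^sub>m (dim_row B)"
    using assms(2) Ac by (auto simp: invertible_mat_def inverts_mat_def)
  \<comment> \<open>The shape of B is read off by comparing column counts in the two inverse
    identities.\<close>
  have "dim_col B = n + n" using arg_cong[OF B(1), of dim_col] by simp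
  moreover have "dim_row B = n + n" using arg_cong[OF B(2), of dim_col] Ac by simp
  ultimately have Bc: "B \<in> carrier_mat (n + n) (n + n)" by auto
  have "B * matAt N \<kappa> = 1\<^sub>m (n + n)" using B(2) Bc by simp
  note V = mat_inv[OF Ac Bc B(1) this]
  \<comment> \<open>As A = At + E, the product At^{-1} A is I + At^{-1} E, so the eigenvalue 1
    corresponds to the kernel of At^{-1} E.\<close>
  have VA: "mat_inv (matAt N \<kappa>) * matA N \<kappa> = 1\<^sub>m (n + n) + mat_inv (matAt N \<kappa>) * E"
    unfolding A V(3)[symmetric] by (rule mult_add_distrib_mat[OF V(1) Ac Ec])
  have VE: "mat_inv (matAt N \<kappa>) * E \<in> carrier_mat (n + n) (n + n)" using V(1) Ec by simp
  have "char_matrix (mat_inv (matAt N \<kappa>) * matA N \<kappa>) 1 = mat_inv (matAt N \<kappa>) * E"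
    unfolding VA by (rule char_matrix_one_add[OF VE])
  moreover have "mat_kernel (mat_inv (matAt N \<kappa>) * E) = mat_kernel E"
    \<comment> \<open>Left multiplication by the invertible At^{-1} leaves the kernel of E
      unchanged.\<close>
    by (rule mat_kernel_mult_eq[OF Ec V(1) Ac V(2)])
  hence "kernel_dim (mat_inv (matAt N \<kappa>) * E) = kernel_dim E"
    using VE Ec by (simp add: kernel_dim_def)
  \<comment> \<open>Here m = N - 3: each slot has N - 1 positions, of which the last two are forced
    to vanish.\<close>
  moreover have "kernel_dim E = 2 * (N - 3) ^ 3"
    unfolding E_def by (rule kernel_dim_defect[OF refl R M H W WM MW _ ker]) auto
  ultimately show ?thesis by simp
qed

end
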